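(* Let $k\ge 2$ and let $T$ be any standard staircase-shape Young tableau of size $k$. There exist positive constants $c_1',c_2',c_3'$, depending only on $k$, such that for every $n\ge k$, with probability at least $1-e^{-c_3' n}$, a uniformly random standard staircase-shape Young tableau of size $n$ contains at least $c_1' n$ subtableaux with pairwise disjoint supports such that: (1) each of these subtableaux is identically ordered with $T$; (2) all the entries of these subtableaux are greater than $N-c_2' n$, where $N=\binom n2$.
   Context: A Young diagram with row lengths $\lambda_1\ge\lambda_2\ge\dots\ge0$ (integers with $|\lambda|:=\sum_i\lambda_i<\infty$) is the set $\lambda=\{(i,j)\in\mathbb N^2: 1\le j\le\lambda_i\}$, where $\mathbb N=\{1,2,\dots\}$; its elements are called boxes. A tableau of shape $\lambda$ is a map from $\lambda$ to the integers whose values (entries) are non-decreasing along rows and columns. A standard Young tableau of shape $\lambda$ is a tableau of shape $\lambda$ whose set of entries is $\{1,2,\dots,|\lambda|\}$. A standard staircase-shape Young tableau of size $n$ is a standard Young tableau of shape $(n-1,n-2,\dots,1)$ (the staircase Young diagram of size $n$); it has $N=\binom n2$ boxes. "Uniformly random" means chosen uniformly from the finite set of all such tableaux. Write $(i,j)\le(k,\ell)$ if $i\le k$ and $j\le\ell$. For a Young diagram $\lambda$ and a box $(i,j)\in\lambda$, the subdiagram with top-left corner $(i,j)$ is $\lambda^{(i,j)}:=\{(k,\ell)\in\lambda:(k,\ell)\ge(i,j)\}$. If $U$ is a tableau of shape $\lambda$, the subtableau $U^{(i,j)}$ is the restriction of $U$ to $\lambda^{(i,j)}$, and $\lambda^{(i,j)}$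 is called its support. If $S$ and $U$ are tableaux or subtableaux and there is a translation $\theta$ mapping the support of $S$ bijectively onto the support of $U$ (the support of a tableau is its shape), then $S$ and $U$ are identically ordered if for all $x,y$ in the support of $S$ one has $S(x)<S(y)$ if and only if $U(\theta(x))<U(\theta(y))$. *)

theory Defs
  imports "HOL-Probability.Probability" "HOL-Library.Product_Order"
begin

text \<open>
  Boxes are pairs (row, column), counted from 1. The order \<open>\<le>\<close> on boxes is the
  componentwise one of \<^theory>\<open>HOL-Library.Product_Order\<close>.
\<close>

type_synonym box = "nat \<times> nat"

text \<open>
  The row lengths are a function on the positive integers; the value at 0 is irrelevant.
\<close>

definition young_diagram :: "(nat \<Rightarrow> nat) \<Rightarrow> box set" where
  "young_diagram r = {(i, j). 1 \<le> i \<and> 1 \<le> j \<and> j \<le> r i}"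

text \<open>Truncated subtraction yields the row lengths \<open>n - 1, n - 2, \<dots>, 1, 0, 0, \<dots>\<close>.\<close>

definition staircase :: "nat \<Rightarrow> box set" where
  "staircase n = young_diagram (\<lambda>i. n - i)"

definition subdiagram :: "box set \<Rightarrow> box \<Rightarrow> box set" where
  "subdiagram D b = {c \<in> D. b \<le> c}"

text \<open>
  Tableaux and subtableaux are partial functions, so that the support is
  \<^const>\<open>dom\<close> and the set of entries is \<^const>\<open>ran\<close>; in particular a (sub)tableau carries
  no information outside its support.
\<close>

type_synonym tableau = "box \<rightharpoonup> int"

definition is_tableau :: "box set \<Rightarrow> tableau \<Rightarrow> bool" where
  "is_tableau D U \<longleftrightarrow> dom U = D \<and>
     (\<forall>i j l. (i, j) \<in> D \<longrightarrow> (i, l) \<in> D \<longrightarrow> j \<le> l \<longrightarrow> the (U (i, j)) \<le> the (U (i, l))) \<and>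
     (\<forall>i k j. (i, j) \<in> D \<longrightarrow> (k, j) \<in> D \<longrightarrow> i \<le> k \<longrightarrow> the (U (i, j)) \<le> the (U (k, j)))"

definition standard_young_tableaux :: "box set \<Rightarrow> tableau set" where
  "standard_young_tableaux D = {U. is_tableau D U \<and> ran U = {1..int (card D)}}"

definition staircase_tableaux :: "nat \<Rightarrow> tableau set" where
  "staircase_tableaux n = standard_young_tableaux (staircase n)"

definition subtableau :: "tableau \<Rightarrow> box \<Rightarrow> tableau" where
  "subtableau U b = U |` subdiagram (dom U) b"

definition subtableaux :: "tableau \<Rightarrow> tableau set" where
  "subtableaux U = subtableau U ` dom U"

text \<open>The components of a translation vector may be negative.\<close>

definition translation_on :: "box set \<Rightarrow> (box \<Rightarrow> box) \<Rightarrow> bool" where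
  "translation_on A \<theta> \<longleftrightarrow>
     (\<exists>a b :: int. \<forall>x\<in>A. int (fst (\<theta> x)) = int (fst x) + a \<and> int (snd (\<theta> x)) = int (snd x) + b)"

definition identically_ordered :: "tableau \<Rightarrow> tableau \<Rightarrow> bool" where
  "identically_ordered S U \<longleftrightarrow>
     (\<exists>\<theta>. translation_on (dom S) \<theta> \<and> bij_betw \<theta> (dom S) (dom U) \<and>
        (\<forall>x\<in>dom S. \<forall>y\<in>dom S. the (S x) < the (S y) \<longleftrightarrow> the (U (\<theta> x)) < the (U (\<theta> y))))"

lemma staircase_iff: "(i, j) \<in> staircase n \<longleftrightarrow> 1 \<le> i \<and> 1 \<le> j \<and> i + j \<le> n"
  by (auto simp: staircase_def young_diagram_def)

lemma finite_staircase: "finite (staircase n)"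
proof (rule finite_subset)
  show "staircase n \<subseteq> {..n} \<times> {..n}"
    by (auto simp: staircase_iff)
qed auto

lemma card_staircase: "card (staircase n) = n choose 2"
proof -
  have "staircase n = (SIGMA i:{1..n}. {1..n - i})"
    by (auto simp: staircase_iff)
  hence "card (staircase n) = (\<Sum>i\<in>{1..n}. n - i)"
    by simp
  also have "\<dots> = (\<Sum>i<n. i)"
    by (rule sum.reindex_bij_witness[of _ "\<lambda>i. n - i" "\<lambda>i. n - i"]) auto
  also have "\<dots> = n choose 2"
    by (induction n) (auto simp: numeral_2_eq_2)
  finally show ?thesis .
qed

lemma finite_standard_young_tableaux:
  assumes "finite D"
  shows "finite (standard_young_tableaux D)"
proof (rule finite_subset)
  show "standard_young_tableaux D \<subseteq> {U. dom U = D \<and> ran U \<subseteq> {1..int (card D)}}"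
    by (auto simp: standard_young_tableaux_def is_tableau_def)
qed (use assms in \<open>auto intro: finite_set_of_finite_maps\<close>)

lemma ex_linear_extension:
  fixes D :: "'a :: order set"
  assumes "finite D"
  shows "\<exists>f. f ` D = {1..int (card D)} \<and> (\<forall>x\<in>D. \<forall>y\<in>D. x \<le> y \<longrightarrow> f x \<le> f y)"
  using assms
proof (induction "card D" arbitrary: D)
  case 0
  thus ?case by simp
next
  case (Suc m D)
  have "D \<noteq> {}" using Suc.hyps(2) by auto
  then obtain z where z: "z \<in> D" "\<And>y. y \<in> D \<Longrightarrow> z \<le> y \<Longrightarrow> z = y"
    using finite_has_maximal[OF Suc.prems] by metis
  have card: "card (D - {z}) = m" using z Suc.hyps(2) Suc.prems by simp
  then obtain f where f: "f ` (D - {z}) = {1..int m}"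
      "\<forall>x\<in>D - {z}. \<forall>y\<in>D - {z}. x \<le> y \<longrightarrow> f x \<le> f y"
    using Suc.hyps(1)[of "D - {z}"] Suc.prems by auto
  define g where "g = f(z := int (Suc m))"
  have "g ` D = insert (int (Suc m)) (f ` (D - {z}))"
    using z by (auto simp: g_def)
  also have "\<dots> = {1..int (card D)}"
    unfolding f(1) Suc.hyps(2)[symmetric] by auto
  finally have "g ` D = {1..int (card D)}" .
  moreover have "g x \<le> g y" if "x \<in> D" "y \<in> D" "x \<le> y" for x y
  proof (cases "y = z")
    case True
    thus ?thesis using that f(1) by (force simp: g_def)
  next
    case False
    thus ?thesis using that f(2) z(2) by (auto simp: g_def)
  qed
  ultimately show ?case by blast
qed

text \<open>
  Hence \<open>pmf_of_set (staircase_tableaux n)\<close> is the uniform distribution on the standard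
  staircase-shape tableaux of size \<open>n\<close>.
\<close>

lemma finite_staircase_tableaux: "finite (staircase_tableaux n)"
  unfolding staircase_tableaux_def
  by (intro finite_standard_young_tableaux finite_staircase)

lemma staircase_tableaux_nonempty: "staircase_tableaux n \<noteq> {}"
proof -
  let ?D = "staircase n"
  obtain f where f: "f ` ?D = {1..int (card ?D)}"
      "\<And>x y. x \<in> ?D \<Longrightarrow> y \<in> ?D \<Longrightarrow> x \<le> y \<Longrightarrow> f x \<le> f y"
    using ex_linear_extension[OF finite_staircase] by metis
  define U where "U = (\<lambda>x. if x \<in> ?D then Some (f x) else None)"
  have "dom U = ?D" "ran U = f ` ?D"
    by (auto simp: U_def ran_def split: if_splits)
  hence "U \<in> staircase_tableaux n"
    using f by (auto simp: staircase_tableaux_def standard_young_tableaux_def is_tableau_def U_def)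
  thus ?thesis by blast
qed

end

theory Submission
  imports Defs "HOL-Library.Sublist"
begin

text \<open>
  Read the entries in decreasing order: a uniform standard tableau becomes a uniformly random order
  of removing corners from the staircase. By the Frobenius formula, the probability that the next
  removed corner lies in row \<open>i\<close> is \<open>l\<^sub>i / \<bar>\<lambda>\<bar> \<cdot> \<Prod>\<^sub>j\<^sub>\<noteq>\<^sub>i (1 - 1 / (l\<^sub>i - l\<^sub>j))\<close> with \<open>l\<^sub>j = \<lambda>\<^sub>j + n - j\<close>.
  Whatever the current diagram is, this has two consequences: a corner near the antidiagonal in the
  middle rows is removed with probability at least \<open>c / n\<close>, and the removal probabilities of two
  nearby corners are comparable. Place linearly many disjoint translates of the staircase of size
  \<open>k\<close> along the middle of the antidiagonal. Whenever a box of one of them is removed, it is the box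
  prescribed by \<open>T\<close> with probability bounded below. An exponential supermartingale that multiplies
  one factor per translate shows that after a linear number of steps linearly many translates have
  been removed completely in the order of \<open>T\<close>, up to an exponentially small probability.
\<close>

text \<open>The obstacle is dependence on the past: earlier removals shape the current diagram,
  which need not look typical. Both estimates are therefore proved for every down-set of the
  staircase, and each conditional probability is handled as a quotient of two numbers of removal
  orders, until the final counts become probabilities.

  No closed evaluation of the Frobenius product is needed. Containment in the staircase bounds every
  \<open>l_j\<close> above, which suffices for the lower bound at a corner close to the
  antidiagonal; for two nearby corners the factors agree up to errors that are summable because the
  \<open>l_j\<close> are distinct integers.

  A block advances at a rate of order 1/n only, so linearly many steps are needed before each
  unfinished block gains a factor e in the exponential term. A block that is finished or still on
  course costs at most a factor 2 in the product of weights. Hence a small mean is possible only if,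
  typically, many blocks have finished.

  The finitely many sizes with no room for the blocks are covered by one explicit tableau and a
  smaller constant in the exponent.\<close>

section \<open>Removal orders and disjoint blocks\<close>

text \<open>Linear extensions read from the top. Any repetition would violate
  \<open>\<not> x \<le> y\<close> by reflexivity, so distinctness needs no clause of its
  own.\<close>

definition removal_orders :: "'a::order set \<Rightarrow> 'a list set" where
  "removal_orders D = {xs. set xs = D \<and> sorted_wrt (\<lambda>x y. \<not> x \<le> y) xs}"

definition maximals :: "'a::order set \<Rightarrow> 'a set" where
  "maximals D = {x \<in> D. \<forall>y\<in>D. x \<le> y \<longrightarrow> y = x}"

lemma maximals_subset: "maximals D \<subseteq> D"
  by (auto simp: maximals_def)

lemma removal_orders_empty [simp]: "removal_orders {} = {[]}"
  by (auto simp: removal_orders_def)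

lemma removal_orders_distinct:
  assumes "xs \<in> removal_orders D"
  shows "distinct xs"
proof -
  have "distinct xs" if "sorted_wrt (\<lambda>x y. \<not> x \<le> y) xs" for xs :: "'a list"
    using that by (induction xs) auto
  thus ?thesis using assms by (auto simp: removal_orders_def)
qed

lemma removal_orders_length: "xs \<in> removal_orders D \<Longrightarrow> length xs = card D"
  using removal_orders_distinct[of xs D] distinct_card[of xs]
  by (auto simp: removal_orders_def)

lemma Cons_in_removal_orders:
  "x # xs \<in> removal_orders D \<longleftrightarrow> x \<in> maximals D \<and> xs \<in> removal_orders (D - {x})"
proof
  assume *: "x # xs \<in> removal_orders D"
  hence "distinct (x # xs)" by (rule removal_orders_distinct)
  with * show "x \<in> maximals D \<and> xs \<in> removal_orders (D - {x})"
    by (auto simp: removal_orders_def maximals_def)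
qed (auto simp: removal_orders_def maximals_def)

lemma finite_removal_orders:
  assumes "finite D"
  shows "finite (removal_orders D)"
proof (rule finite_subset)
  show "removal_orders D \<subseteq> {xs. set xs \<subseteq> D \<and> length xs = card D}"
    using removal_orders_length by (auto simp: removal_orders_def)
qed (use finite_lists_length_eq[OF assms] in auto)

lemma removal_orders_decomp:
  assumes "D \<noteq> {}"
  shows "removal_orders D = (\<Union>x\<in>maximals D. (#) x ` removal_orders (D - {x}))"
proof (intro set_eqI iffI)
  fix xs assume "xs \<in> removal_orders D"
  moreover from this obtain x ys where "xs = x # ys"
    using assms by (cases xs) (auto simp: removal_orders_def)
  ultimately show "xs \<in> (\<Union>x\<in>maximals D. (#) x ` removal_orders (D - {x}))"
    by (auto simp: Cons_in_removal_orders)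
qed (auto simp: Cons_in_removal_orders)

text \<open>The law of total expectation: given the first element \<open>x\<close>, the rest is
  uniform on the orders of \<open>D - {x}\<close>. Hence \<open>x\<close> comes first with
  probability \<open>card (removal_orders (D - {x})) / card (removal_orders D)\<close>, and sums
  weighted by these cardinalities stand in for expectations below.\<close>

lemma sum_removal_orders:
  assumes "finite D" "D \<noteq> {}"
  shows "(\<Sum>xs\<in>removal_orders D. f xs) =
    (\<Sum>x\<in>maximals D. \<Sum>xs\<in>removal_orders (D - {x}). f (x # xs))"
proof -
  have "finite (maximals D)"
    using assms maximals_subset finite_subset by blast
  hence "(\<Sum>xs\<in>removal_orders D. f xs) =
      (\<Sum>x\<in>maximals D. \<Sum>xs\<in>(#) x ` removal_orders (D - {x}). f xs)"
    unfolding removal_orders_decomp[OF assms(2)]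
    by (intro sum.UNION_disjoint) (use assms in \<open>auto intro: finite_removal_orders\<close>)
  thus ?thesis by (simp add: sum.reindex)
qed

lemma card_removal_orders:
  assumes "finite D" "D \<noteq> {}"
  shows "card (removal_orders D) = (\<Sum>x\<in>maximals D. card (removal_orders (D - {x})))"
  using sum_removal_orders[OF assms, of "\<lambda>_. 1::nat"] by simp

lemma removal_orders_nonempty:
  assumes "finite D"
  shows "removal_orders D \<noteq> {}"
  using assms
proof (induction D rule: finite_psubset_induct)
  case (psubset D)
  show ?case
  proof (cases "D = {}")
    case False
    then obtain x where x: "x \<in> D" "\<And>y. y \<in> D \<Longrightarrow> x \<le> y \<Longrightarrow> x = y"
      using finite_has_maximal[OF psubset.hyps] by metis
    hence "x \<in> maximals D" by (auto simp: maximals_def)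
    moreover obtain xs where "xs \<in> removal_orders (D - {x})"
      using psubset.IH[of "D - {x}"] x by auto
    ultimately have "x # xs \<in> removal_orders D" by (simp add: Cons_in_removal_orders)
    thus ?thesis by blast
  qed simp
qed

text \<open>Nothing outside an up-set lies above its elements, so it may be exhausted first. For
  small n this yields one favourable order.\<close>

lemma removal_orders_append:
  assumes "ys \<in> removal_orders S" "zs \<in> removal_orders (D - S)" "S \<subseteq> D"
    and "\<And>x y. x \<in> S \<Longrightarrow> y \<in> D \<Longrightarrow> x \<le> y \<Longrightarrow> y \<in> S"
  shows "ys @ zs \<in> removal_orders D"
  using assms by (auto simp: removal_orders_def sorted_wrt_append)

text \<open>Ensures that a block which has followed its prescribed order so far can take the next
  prescribed step.\<close>

lemma removal_orders_nth_maximal: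
  assumes "xs \<in> removal_orders S" "j < length xs"
  shows "xs ! j \<in> maximals (S - set (take j xs))"
proof -
  have "drop j xs \<in> removal_orders (S - set (take j xs))"
  proof -
    have "distinct xs" by (rule removal_orders_distinct[OF assms(1)])
    hence "set (take j xs) \<inter> set (drop j xs) = {}"
      by (metis append_take_drop_id distinct_append)
    moreover have "set xs = set (take j xs) \<union> set (drop j xs)"
      by (metis append_take_drop_id set_append)
    ultimately have "set (drop j xs) = S - set (take j xs)"
      using assms(1) by (auto simp: removal_orders_def)
    thus ?thesis using assms(1) by (auto simp: removal_orders_def sorted_wrt_drop)
  qed
  thus ?thesis
    using assms(2) by (metis Cons_in_removal_orders Cons_nth_drop_Suc)
qed

section \<open>The exponential supermartingale for disjoint blocks\<close>

text \<open>Isolates the two facts about the staircase that the process needs. The sets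
  \<open>D\<close> are the down-sets of \<open>X\<close>, that is, whatever can remain after some
  removals. \<open>rate\<close> bounds below the chance of any available element of a block;
  \<open>ratio\<close> says that its competitors in the same block are together at most
  \<open>C\<close> times as likely.\<close>

locale blocks =
  fixes X :: "'a::order set" and I :: "'b set" and S :: "'b \<Rightarrow> 'a set" and \<tau> :: "'b \<Rightarrow> 'a list"
    and M :: nat and C \<rho> :: real
  assumes finite_X: "finite X" and finite_I: "finite I"
    and S_subset: "b \<in> I \<Longrightarrow> S b \<subseteq> X"
    and S_upset: "b \<in> I \<Longrightarrow> x \<in> S b \<Longrightarrow> y \<in> X \<Longrightarrow> x \<le> y \<Longrightarrow> y \<in> S b"
    and S_disjoint: "b \<in> I \<Longrightarrow> b' \<in> I \<Longrightarrow> b \<noteq> b' \<Longrightarrow> S b \<inter> S b' = {}"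
    and \<tau>: "b \<in> I \<Longrightarrow> \<tau> b \<in> removal_orders (S b)"
    and card_S: "b \<in> I \<Longrightarrow> card (S b) = M"
    and C_nonneg: "C \<ge> 0" and \<rho>_nonneg: "\<rho> \<ge> 0"
    and rate: "D \<subseteq> X \<Longrightarrow> (\<And>x y. x \<in> D \<Longrightarrow> y \<in> X \<Longrightarrow> y \<le> x \<Longrightarrow> y \<in> D) \<Longrightarrow> b \<in> I \<Longrightarrow>
      x \<in> maximals D \<inter> S b \<Longrightarrow>
      \<rho> * card (removal_orders D) \<le> card (removal_orders (D - {x}))"
    and ratio: "D \<subseteq> X \<Longrightarrow> (\<And>x y. x \<in> D \<Longrightarrow> y \<in> X \<Longrightarrow> y \<le> x \<Longrightarrow> y \<in> D) \<Longrightarrow> b \<in> I \<Longrightarrow>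
      x \<in> maximals D \<inter> S b \<Longrightarrow>
      (\<Sum>y\<in>maximals D \<inter> S b - {x}. real (card (removal_orders (D - {y}))))
        \<le> C * card (removal_orders (D - {x}))"
begin

text \<open>Normalised by \<open>\<eta> M = 1 / 2\<close>, so that no weight drops below 1/2. A
  correct step changes the weight by \<open>- (1 + C) * \<eta> j\<close>, a wrong one by
  \<open>\<eta> j\<close>; with wrong steps at most \<open>C\<close> times as likely, a net decrease
  of \<open>\<eta> j\<close> per unit of the correct step's probability remains.\<close>

definition \<eta> :: "nat \<Rightarrow> real" where "\<eta> j = (1 / 2) * (2 + C) ^ j / (2 + C) ^ M"

definition trace :: "'b \<Rightarrow> 'a list \<Rightarrow> 'a list" where "trace b h = filter (\<lambda>x. x \<in> S b) h"

text \<open>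
  The weight of a block that is still following the prescribed order decreases with the progress
  made. The recursion for \<open>\<eta>\<close> makes the gain of a correct step outweigh the loss of a wrong one,
  which is at most \<open>C\<close> times as likely.
\<close>

definition pot :: "'b \<Rightarrow> 'a list \<Rightarrow> real" where
  "pot b h = (if prefix (trace b h) (\<tau> b) then 1 - \<eta> (length (trace b h)) else 1)"

definition total_pot :: "'a list \<Rightarrow> real" where "total_pot h = (\<Prod>b\<in>I. pot b h)"

text \<open>A block that has deviated from its order belongs neither here nor to
  \<open>finished\<close>; its weight is 1 from then on.\<close>

definition unfinished :: "'a list \<Rightarrow> 'b set" where
  "unfinished h = {b \<in> I. strict_prefix (trace b h) (\<tau> b)}"

definition finished :: "'a list \<Rightarrow> 'b set" where
  "finished h = {b \<in> I. trace b h = \<tau> b}"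

lemma \<eta>_Suc: "\<eta> (Suc j) = (2 + C) * \<eta> j"
  by (simp add: \<eta>_def)

lemma \<eta>_pos: "\<eta> j > 0"
  using C_nonneg by (simp add: \<eta>_def)

lemma \<eta>_le_half: "j \<le> M \<Longrightarrow> \<eta> j \<le> 1 / 2"
  using C_nonneg power_increasing[of j M "2 + C"] by (simp add: \<eta>_def field_simps)

lemma \<eta>_mono: "\<eta> 0 \<le> \<eta> j"
proof -
  have "1 \<le> (2 + C) ^ j" using C_nonneg by (intro one_le_power) auto
  thus ?thesis using C_nonneg by (simp add: \<eta>_def field_simps)
qed

lemma length_\<tau>: "b \<in> I \<Longrightarrow> length (\<tau> b) = M"
  using removal_orders_length[OF \<tau>] card_S by simp

lemma set_\<tau>: "b \<in> I \<Longrightarrow> set (\<tau> b) = S b"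
  using \<tau> by (auto simp: removal_orders_def)

lemma prefix_length_le_M: "b \<in> I \<Longrightarrow> prefix u (\<tau> b) \<Longrightarrow> length u \<le> M"
  using prefix_length_le length_\<tau> by metis

lemma pot_ge_half: "b \<in> I \<Longrightarrow> pot b h \<ge> 1 / 2"
  using \<eta>_le_half prefix_length_le_M by (auto simp: pot_def)

lemma pot_pos: "b \<in> I \<Longrightarrow> pot b h > 0"
  using pot_ge_half[of b h] by simp

lemma total_pot_pos: "total_pot h > 0"
  unfolding total_pot_def by (intro prod_pos) (auto intro: pot_pos)

lemma trace_append: "trace b (h @ h') = trace b h @ trace b h'"
  by (simp add: trace_def)

lemma unfinished_append: "unfinished (h @ h') \<subseteq> unfinished h"
  unfolding unfinished_def trace_append
  by (auto simp: strict_prefix_def dest: append_prefixD)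

lemma finite_unfinished: "finite (unfinished h)"
  unfolding unfinished_def using finite_I by simp

lemma total_pot_snoc_in:
  assumes "b \<in> I" "x \<in> S b"
  shows "total_pot (h @ [x]) = total_pot h * (pot b (h @ [x]) / pot b h)"
proof -
  have "pot b' (h @ [x]) = pot b' h" if "b' \<in> I - {b}" for b'
  proof -
    have "x \<notin> S b'" using that assms S_disjoint[of b b'] by auto
    thus ?thesis by (simp add: pot_def trace_def)
  qed
  hence "(\<Prod>b'\<in>I - {b}. pot b' (h @ [x])) = (\<Prod>b'\<in>I - {b}. pot b' h)"
    by (intro prod.cong) auto
  thus ?thesis
    using pot_pos[OF assms(1), of h]
    unfolding total_pot_def
    by (simp add: prod.remove[OF finite_I assms(1), of "\<lambda>b. pot b h"]
        prod.remove[OF finite_I assms(1), of "\<lambda>b. pot b (h @ [x])"])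
qed

lemma total_pot_snoc_notin:
  assumes "x \<notin> (\<Union>b\<in>I. S b)"
  shows "total_pot (h @ [x]) = total_pot h"
  unfolding total_pot_def using assms by (intro prod.cong) (auto simp: pot_def trace_def)

text \<open>The left side is \<open>card (removal_orders D)\<close> times the expected relative
  change of one weight. For a block on course it is at most \<open>- \<eta> j\<close> times the
  count for the prescribed step, by the choice of \<eta>; \<open>rate\<close> bounds that count
  below. A finished block has nothing left to remove, and a deviated one keeps weight 1.\<close>

lemma block_step:
  assumes h: "set h \<subseteq> X" "\<And>x y. x \<in> X - set h \<Longrightarrow> y \<in> X \<Longrightarrow> y \<le> x \<Longrightarrow> y \<notin> set h"
    and b: "b \<in> I"
  defines "D \<equiv> X - set h"
  shows "(\<Sum>x\<in>maximals D \<inter> S b.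
            card (removal_orders (D - {x})) * (pot b (h @ [x]) / pot b h - 1))
         \<le> (if b \<in> unfinished h then - \<eta> 0 * \<rho> * card (removal_orders D) else 0)"
proof -
  let ?u = "trace b h"
  define w where "w x = real (card (removal_orders (D - {x})))" for x
  have D: "D \<subseteq> X" "\<And>x y. x \<in> D \<Longrightarrow> y \<in> X \<Longrightarrow> y \<le> x \<Longrightarrow> y \<in> D"
    using h by (auto simp: D_def)
  have tr: "trace b (h @ [x]) = ?u @ [x]" if "x \<in> S b" for x
    using that by (simp add: trace_def)
  have set_u: "set ?u = S b \<inter> set h"
    by (auto simp: trace_def)
  have fin: "finite (maximals D \<inter> S b)"
    using finite_X S_subset[OF b] finite_subset by blast
  consider (unf) "strict_prefix ?u (\<tau> b)" | (fin) "?u = \<tau> b" | (bad) "\<not> prefix ?u (\<tau> b)"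
    by (auto simp: strict_prefix_def)
  thus ?thesis
  proof cases
    case unf
    define j where "j = length ?u"
    obtain y v where "\<tau> b = ?u @ y # v"
      using unf by (metis strict_prefixE')
    hence y: "\<tau> b = ?u @ [y] @ v" by simp
    have j: "j < length (\<tau> b)" "\<tau> b ! j = y" "take j (\<tau> b) = ?u"
      by (simp_all add: j_def y)
    have jM: "j < M" using j length_\<tau>[OF b] by simp
    have "y \<in> maximals (S b - set ?u)"
      using removal_orders_nth_maximal[OF \<tau>[OF b] j(1)] j by simp
    moreover have "S b - set ?u = D \<inter> S b"
      using set_u S_subset[OF b] by (auto simp: D_def)
    \<comment> \<open>Because \<open>S b\<close> is an up-set of \<open>X\<close>, an element
      maximal in what is left of the block is maximal in all of \<open>D\<close>, so the prescribed
      step is really available.\<close>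
    ultimately have y_max: "y \<in> maximals D \<inter> S b"
      using S_upset[OF b] D(1) by (auto simp: maximals_def)
    have pot_h: "pot b h = 1 - \<eta> j"
      using unf by (auto simp: pot_def j_def strict_prefix_def)
    have pot_y: "pot b (h @ [y]) = 1 - \<eta> (Suc j)"
      using y_max y tr by (auto simp: pot_def j_def prefix_def)
    have pot_x: "pot b (h @ [x]) = 1" if "x \<in> maximals D \<inter> S b - {y}" for x
      using that y tr by (auto simp: pot_def prefix_def)
    have pos: "1 - \<eta> j > 0" using \<eta>_le_half[of j] jM by simp
    have "(\<Sum>x\<in>maximals D \<inter> S b. w x * (pot b (h @ [x]) / pot b h - 1)) =
        w y * ((1 - \<eta> (Suc j)) / (1 - \<eta> j) - 1)
         + (\<Sum>x\<in>maximals D \<inter> S b - {y}. w x * (1 / (1 - \<eta> j) - 1))"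
      unfolding sum.remove[OF fin y_max] pot_h pot_y
      by (intro arg_cong2[of _ _ _ _ "(+)"] sum.cong refl) (simp add: pot_x)
    also have "\<dots> = (w y * (\<eta> j - \<eta> (Suc j)) + \<eta> j * (\<Sum>x\<in>maximals D \<inter> S b - {y}. w x)) / (1 - \<eta> j)"
    proof -
      have "(1 - \<eta> (Suc j)) / (1 - \<eta> j) - 1 = (\<eta> j - \<eta> (Suc j)) / (1 - \<eta> j)"
        "1 / (1 - \<eta> j) - 1 = \<eta> j / (1 - \<eta> j)"
        using pos by (simp_all add: field_simps)
      thus ?thesis
        by (simp only: sum_distrib_right[symmetric])
           (simp add: add_divide_distrib mult.commute)
    qed
    \<comment> \<open>\<open>ratio\<close> is applied with the prescribed element as reference: all
      wrong steps of this block together weigh at most \<open>C * w y\<close>.\<close>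
    also have "\<dots> \<le> (w y * (\<eta> j - \<eta> (Suc j)) + \<eta> j * (C * w y)) / (1 - \<eta> j)"
      using ratio[OF D b y_max] pos \<eta>_pos[of j]
      by (intro divide_right_mono add_left_mono mult_left_mono) (auto simp: w_def)
    also have "\<dots> = - (\<eta> j * w y) / (1 - \<eta> j)"
      by (simp add: \<eta>_Suc algebra_simps)
    also have "\<dots> \<le> - (\<eta> j * w y)"
    proof -
      have "\<eta> j * w y \<le> \<eta> j * w y / (1 - \<eta> j)"
        using pos \<eta>_pos[of j] by (simp add: pos_le_divide_eq w_def mult_left_le)
      thus ?thesis by simp
    qed
    also have "\<dots> \<le> - (\<eta> 0 * (\<rho> * card (removal_orders D)))"
      using rate[OF D b y_max] \<eta>_mono[of j] \<eta>_pos[of j] \<rho>_nonneg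
      by (simp add: w_def mult_mono)
    finally show ?thesis
      using unf b by (simp add: unfinished_def w_def)
  next
    case fin
    hence "S b \<inter> D = {}"
      using set_u set_\<tau>[OF b] by (auto simp: D_def)
    hence "maximals D \<inter> S b = {}"
      using maximals_subset by blast
    thus ?thesis using fin by (simp add: unfinished_def)
  next
    case bad
    hence "pot b (h @ [x]) = 1" for x
      using append_prefixD by (auto simp: pot_def trace_append)
    moreover have "pot b h = 1" using bad by (simp add: pot_def)
    ultimately show ?thesis using bad by (simp add: unfinished_def strict_prefix_def)
  qed
qed

text \<open>A removed element lies in at most one block, so at most one factor of
  \<open>total_pot\<close> changes. The relative change of the product is thus the sum of the
  relative changes of the single weights, without cross terms.\<close>

lemma step:
  assumes h: "set h \<subseteq> X" "\<And>x y. x \<in> X - set h \<Longrightarrow> y \<in> X \<Longrightarrow> y \<le> x \<Longrightarrow> y \<notin> set h"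
  defines "D \<equiv> X - set h"
  assumes "D \<noteq> {}"
  shows "(\<Sum>x\<in>maximals D. card (removal_orders (D - {x})) * total_pot (h @ [x]))
    \<le> card (removal_orders D) * total_pot h * (1 - \<eta> 0 * \<rho> * card (unfinished h))"
proof -
  define w where "w x = real (card (removal_orders (D - {x})))" for x
  define r where "r x = total_pot (h @ [x]) / total_pot h - 1" for x
  have fin: "finite D" "finite (maximals D)"
    using finite_X maximals_subset[of D] finite_subset by (auto simp: D_def)
  have "(\<Sum>x\<in>maximals D. w x * r x) = (\<Sum>x\<in>(\<Union>b\<in>I. maximals D \<inter> S b). w x * r x)"
  proof (intro sum.mono_neutral_right ballI)
    fix x assume "x \<in> maximals D - (\<Union>b\<in>I. maximals D \<inter> S b)"
    hence "r x = 0"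
      using total_pot_snoc_notin[of x h] total_pot_pos[of h] by (auto simp: r_def)
    thus "w x * r x = 0" by simp
  qed (use fin in auto)
  also have "\<dots> = (\<Sum>b\<in>I. \<Sum>x\<in>maximals D \<inter> S b. w x * r x)"
    using fin finite_I S_disjoint by (intro sum.UNION_disjoint) blast+
  also have "\<dots> = (\<Sum>b\<in>I. \<Sum>x\<in>maximals D \<inter> S b. w x * (pot b (h @ [x]) / pot b h - 1))"
  proof (intro sum.cong refl)
    fix b x assume "b \<in> I" "x \<in> maximals D \<inter> S b"
    thus "w x * r x = w x * (pot b (h @ [x]) / pot b h - 1)"
      using total_pot_snoc_in[of b x h] total_pot_pos[of h] by (simp add: r_def)
  qed
  also have "\<dots> \<le> (\<Sum>b\<in>I. if b \<in> unfinished h then - \<eta> 0 * \<rho> * card (removal_orders D) else 0)"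
    unfolding w_def D_def by (intro sum_mono block_step h) auto
  also have "\<dots> = - \<eta> 0 * \<rho> * card (removal_orders D) * card (unfinished h)"
  proof -
    have "I \<inter> unfinished h = unfinished h" by (auto simp: unfinished_def)
    thus ?thesis by (simp add: sum.If_cases[OF finite_I] mult.commute)
  qed
  finally have "(\<Sum>x\<in>maximals D. w x * r x) \<le> - \<eta> 0 * \<rho> * card (removal_orders D) * card (unfinished h)" .
  hence "(\<Sum>x\<in>maximals D. w x) + (\<Sum>x\<in>maximals D. w x * r x)
      \<le> card (removal_orders D) * (1 - \<eta> 0 * \<rho> * card (unfinished h))"
    using card_removal_orders[OF fin(1) \<open>D \<noteq> {}\<close>] by (simp add: w_def algebra_simps)
  moreover have "(\<Sum>x\<in>maximals D. w x) + (\<Sum>x\<in>maximals D. w x * r x)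
      = (\<Sum>x\<in>maximals D. w x * total_pot (h @ [x])) / total_pot h"
    by (simp add: r_def sum.distrib[symmetric] sum_divide_distrib algebra_simps)
  ultimately show ?thesis
    using total_pot_pos[of h] by (simp add: pos_divide_le_eq w_def mult_ac)
qed

text \<open>The exponent counts the blocks unfinished at the end, and this number only shrinks with
  time. So the decrease \<open>1 - \<kappa> * u \<le> exp (- \<kappa> * u)\<close> from
  \<open>step\<close>, with \<open>u\<close> the current number, pays for the additional factor that
  one more unit of time brings. The history \<open>h\<close> is kept general for the
  induction.\<close>

lemma process:
  assumes "set h \<subseteq> X" "\<And>x y. x \<in> X - set h \<Longrightarrow> y \<in> X \<Longrightarrow> y \<le> x \<Longrightarrow> y \<notin> set h"
  shows "(\<Sum>xs\<in>removal_orders (X - set h). total_pot (h @ take t xs) *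
            exp (\<eta> 0 * \<rho> * t * card (unfinished (h @ take t xs))))
          \<le> card (removal_orders (X - set h)) * total_pot h"
  using assms
proof (induction t arbitrary: h)
  case 0
  show ?case by simp
next
  case (Suc t h)
  define D where "D = X - set h"
  define \<kappa> where "\<kappa> = \<eta> 0 * \<rho>"
  have \<kappa>: "\<kappa> \<ge> 0" using \<eta>_pos[of 0] \<rho>_nonneg by (simp add: \<kappa>_def)
  have finD: "finite D" using finite_X by (simp add: D_def)
  show ?case
  proof (cases "D = {}")
    \<comment> \<open>The time may exceed the number of elements left. Then every block has been
      removed completely, and none can be a proper prefix of its prescribed order.\<close>
    case True
    have "\<not> strict_prefix (trace b h) (\<tau> b)" if b: "b \<in> I" for b
    proof
      assume "strict_prefix (trace b h) (\<tau> b)"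
      then obtain y v where y: "\<tau> b = trace b h @ y # v" by (metis strict_prefixE')
      moreover have "set (trace b h) = S b"
        using True S_subset[OF b] by (auto simp: D_def trace_def)
      ultimately show False
        using removal_orders_distinct[OF \<tau>[OF b]] set_\<tau>[OF b] by auto
    qed
    hence "unfinished h = {}" by (auto simp: unfinished_def)
    moreover have empty: "X - set h = {}" using True by (simp only: D_def)
    ultimately show ?thesis unfolding empty by simp
  next
    case False
    define G where "G h' s = total_pot h' * exp (\<kappa> * real s * card (unfinished h'))" for h' s
    have "(\<Sum>xs\<in>removal_orders D. G (h @ take (Suc t) xs) (Suc t)) =
        (\<Sum>x\<in>maximals D. \<Sum>xs\<in>removal_orders (D - {x}). G ((h @ [x]) @ take t xs) (Suc t))"
      by (subst sum_removal_orders[OF finD False]) simp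
    also have "\<dots> \<le> (\<Sum>x\<in>maximals D. \<Sum>xs\<in>removal_orders (D - {x}).
        G ((h @ [x]) @ take t xs) t * exp (\<kappa> * card (unfinished h)))"
    proof (intro sum_mono)
      fix x xs
      let ?h = "(h @ [x]) @ take t xs"
      have "card (unfinished ?h) \<le> card (unfinished h)"
        by (intro card_mono finite_unfinished) (simp only: append_assoc unfinished_append)
      hence "\<kappa> * real (Suc t) * card (unfinished ?h) \<le> \<kappa> * t * card (unfinished ?h) + \<kappa> * card (unfinished h)"
        using \<kappa> by (simp add: algebra_simps mult_left_mono)
      hence "exp (\<kappa> * real (Suc t) * card (unfinished ?h))
          \<le> exp (\<kappa> * t * card (unfinished ?h)) * exp (\<kappa> * card (unfinished h))"
        by (simp add: exp_add[symmetric])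
      thus "G ?h (Suc t) \<le> G ?h t * exp (\<kappa> * card (unfinished h))"
        using total_pot_pos[of ?h] unfolding G_def by (simp add: mult.assoc)
    qed
    also have "\<dots> = exp (\<kappa> * card (unfinished h)) *
        (\<Sum>x\<in>maximals D. \<Sum>xs\<in>removal_orders (D - {x}). G ((h @ [x]) @ take t xs) t)"
      by (simp add: sum_distrib_left mult.commute)
    also have "\<dots> \<le> exp (\<kappa> * card (unfinished h)) *
        (\<Sum>x\<in>maximals D. card (removal_orders (D - {x})) * total_pot (h @ [x]))"
    proof (intro mult_left_mono sum_mono)
      fix x assume x: "x \<in> maximals D"
      have eq: "X - set (h @ [x]) = D - {x}" by (auto simp: D_def)
      have "(\<Sum>xs\<in>removal_orders (X - set (h @ [x])). G ((h @ [x]) @ take t xs) t)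
          \<le> card (removal_orders (X - set (h @ [x]))) * total_pot (h @ [x])"
        unfolding G_def \<kappa>_def
      proof (rule Suc.IH)
        show "set (h @ [x]) \<subseteq> X" using Suc.prems x by (auto simp: maximals_def D_def)
        show "z \<notin> set (h @ [x])" if "y \<in> X - set (h @ [x])" "z \<in> X" "z \<le> y" for y z
          using that x Suc.prems(2)[of y z] by (auto simp: maximals_def D_def)
      qed
      thus "(\<Sum>xs\<in>removal_orders (D - {x}). G ((h @ [x]) @ take t xs) t)
          \<le> card (removal_orders (D - {x})) * total_pot (h @ [x])"
        unfolding eq .
    qed simp
    also have "\<dots> \<le> exp (\<kappa> * card (unfinished h)) *
        (card (removal_orders D) * total_pot h * (1 - \<kappa> * card (unfinished h)))"
      using step[of h] Suc.prems False by (intro mult_left_mono) (auto simp: D_def \<kappa>_def)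
    also have "\<dots> \<le> exp (\<kappa> * card (unfinished h)) *
        (card (removal_orders D) * total_pot h * exp (- (\<kappa> * card (unfinished h))))"
      using total_pot_pos[of h] exp_ge_add_one_self[of "- (\<kappa> * card (unfinished h))"]
      by (intro mult_left_mono) auto
    also have "\<dots> = card (removal_orders D) * total_pot h"
      by (simp add: exp_minus)
    finally show ?thesis by (simp add: G_def D_def \<kappa>_def)
  qed
qed

text \<open>Markov's inequality for \<open>G\<close>. At such a time the exponential factor is at
  least e per unfinished block, while each finished or unfinished block contributes at least 1/2
  \<ge> 1/e to the product and every other block contributes 1. Hence \<open>G\<close> is at least
  exp of minus the number of finished blocks, whereas its mean is at most
  \<open>(1 - \<eta> 0) ^ card I\<close>.\<close>

theorem few_finished:
  assumes t: "\<eta> 0 * \<rho> * t \<ge> 1"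
  shows "card {xs \<in> removal_orders X. card (finished (take t xs)) \<le> s}
    \<le> card (removal_orders X) * exp (s - \<eta> 0 * card I)"
proof -
  define G where "G xs = total_pot (take t xs) *
    exp (\<eta> 0 * \<rho> * t * card (unfinished (take t xs)))" for xs
  let ?E = "{xs \<in> removal_orders X. card (finished (take t xs)) \<le> s}"
  have finR: "finite (removal_orders X)" using finite_X by (rule finite_removal_orders)
  have G_ge: "G xs \<ge> exp (- real s)" if "xs \<in> ?E" for xs
  proof -
    let ?h = "take t xs"
    let ?F = "finished ?h \<union> unfinished ?h"
    have F: "?F \<subseteq> I" by (auto simp: finished_def unfinished_def)
    have finF: "finite ?F" using F finite_I finite_subset by blast
    have disj: "finished ?h \<inter> unfinished ?h = {}"
      by (auto simp: finished_def unfinished_def)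
    have e: "exp (-1 :: real) \<le> 1 / 2"
      using exp_ge_add_one_self[of "1::real"] by (simp add: exp_minus field_simps)
    have "exp (- real (card ?F)) = (\<Prod>b\<in>?F. exp (-1))"
      by (simp add: exp_of_nat_mult[symmetric])
    also have "\<dots> \<le> (\<Prod>b\<in>?F. pot b ?h)"
    proof (intro prod_mono conjI)
      fix b assume "b \<in> ?F"
      hence "b \<in> I" using F by blast
      thus "exp (- 1) \<le> pot b ?h" using e pot_ge_half[of b ?h] by linarith
    qed simp
    also have "\<dots> = total_pot ?h"
      unfolding total_pot_def
      using F finite_I
      by (intro prod.mono_neutral_left)
         (auto simp: pot_def finished_def unfinished_def strict_prefix_def)
    finally have 1: "total_pot ?h \<ge> exp (- real (card ?F))" .
    have "real (card (unfinished ?h)) \<le> \<eta> 0 * \<rho> * t * card (unfinished ?h)"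
      using mult_right_mono[OF t, of "real (card (unfinished ?h))"] by simp
    hence 2: "exp (real (card (unfinished ?h))) \<le> exp (\<eta> 0 * \<rho> * t * card (unfinished ?h))"
      by simp
    have "exp (- real s) \<le> exp (- real (card (finished ?h)))"
      using that by simp
    also have "\<dots> = exp (- real (card ?F)) * exp (real (card (unfinished ?h)))"
      using finF disj by (simp add: card_Un_disjoint exp_add[symmetric])
    also have "\<dots> \<le> G xs"
      unfolding G_def using 1 2 total_pot_pos[of ?h] by (intro mult_mono) auto
    finally show ?thesis .
  qed
  have "card ?E * exp (- real s) = (\<Sum>xs\<in>?E. exp (- real s))"
    by simp
  also have "\<dots> \<le> (\<Sum>xs\<in>?E. G xs)"
    using G_ge by (rule sum_mono)
  also have "\<dots> \<le> (\<Sum>xs\<in>removal_orders X. G xs)"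
    using finR total_pot_pos by (intro sum_mono2) (auto simp: G_def less_imp_le)
  also have "\<dots> \<le> card (removal_orders X) * total_pot []"
    using process[of "[]" t] unfolding G_def by simp
  also have "total_pot [] = (1 - \<eta> 0) ^ card I"
    by (simp add: total_pot_def pot_def trace_def)
  also have "\<dots> \<le> exp (- \<eta> 0) ^ card I"
    using \<eta>_le_half[of 0] exp_ge_add_one_self[of "- \<eta> 0"] by (intro power_mono) auto
  also have "\<dots> = exp (- \<eta> 0 * card I)"
    by (simp add: exp_of_nat_mult[symmetric] mult.commute)
  finally have "card ?E * exp (- real s) \<le> card (removal_orders X) * exp (- \<eta> 0 * card I)"
    by (simp add: mult_left_mono)
  hence "card ?E * exp (- real s) * exp s \<le> card (removal_orders X) * exp (- \<eta> 0 * card I) * exp s"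
    by (intro mult_right_mono) auto
  thus ?thesis by (simp add: mult.assoc exp_add[symmetric])
qed

end

section \<open>Products over differences\<close>

text \<open>
  With \<open>l\<close> the shifted row lengths, \<open>l i * frob_coeff I l i\<close> is the factor by which the Frobenius
  product changes when row \<open>i\<close> loses a box.
\<close>

definition frob_coeff :: "nat set \<Rightarrow> (nat \<Rightarrow> real) \<Rightarrow> nat \<Rightarrow> real" where
  "frob_coeff I l i = (\<Prod>j\<in>I - {i}. 1 - 1 / (l i - l j))"

lemma frob_coeff_insert:
  assumes "finite I" "a \<notin> I" "i \<in> I"
  shows "frob_coeff (insert a I) l i = frob_coeff I l i * (1 - 1 / (l i - l a))"
proof -
  have "insert a I - {i} = insert a (I - {i})" using assms by auto
  thus ?thesis using assms by (simp add: frob_coeff_def mult.commute)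
qed

lemma frob_coeff_insert_new: "a \<notin> I \<Longrightarrow> frob_coeff (insert a I) l a = (\<Prod>j\<in>I. 1 - 1 / (l a - l j))"
  by (simp add: frob_coeff_def)

text \<open>Partial fractions in \<open>x\<close>: the product tends to 1 at infinity and has simple
  poles at the points \<open>l i\<close> with residues \<open>- frob_coeff I l i\<close>.\<close>

lemma prod_partial_fractions:
  assumes "finite I" "inj_on l I" "x \<notin> l ` I"
  shows "(\<Prod>j\<in>I. 1 - 1 / (x - l j)) = 1 - (\<Sum>i\<in>I. frob_coeff I l i / (x - l i))"
  using assms
proof (induction I arbitrary: x rule: finite_induct)
  case empty
  show ?case by simp
next
  case (insert a I)
  let ?A = "frob_coeff I l"
  have x: "x \<noteq> l a" "\<And>i. i \<in> I \<Longrightarrow> x \<noteq> l i" and a: "\<And>i. i \<in> I \<Longrightarrow> l a \<noteq> l i"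
    using insert by (auto simp: inj_on_def)
  have IHx: "(\<Prod>j\<in>I. 1 - 1 / (x - l j)) = 1 - (\<Sum>i\<in>I. ?A i / (x - l i))"
    and IHa: "(\<Prod>j\<in>I. 1 - 1 / (l a - l j)) = 1 - (\<Sum>i\<in>I. ?A i / (l a - l i))"
    using insert.prems insert.hyps by (auto intro!: insert.IH)
  have "frob_coeff (insert a I) l i / (x - l i) =
      ?A i / (x - l i) - ?A i / (x - l i) / (x - l a) + ?A i / (l a - l i) / (x - l a)" if "i \<in> I" for i
  proof -
    \<comment> \<open>Splits \<open>1 / ((x - l i) * (x - l a))\<close> into partial
      fractions.\<close>
    have "(1 - 1 / (l i - l a)) / (x - l i) =
        1 / (x - l i) - 1 / (x - l i) / (x - l a) + 1 / (l a - l i) / (x - l a)"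
      using x(1) x(2)[OF that] a[OF that] a[OF that, symmetric]
      by (simp add: divide_simps) (simp add: algebra_simps)
    hence "?A i * ((1 - 1 / (l i - l a)) / (x - l i)) =
        ?A i * (1 / (x - l i) - 1 / (x - l i) / (x - l a) + 1 / (l a - l i) / (x - l a))"
      by (rule arg_cong)
    thus ?thesis
      by (simp add: frob_coeff_insert insert.hyps that ring_distribs)
  qed
  hence "(\<Sum>i\<in>I. frob_coeff (insert a I) l i / (x - l i)) =
      (\<Sum>i\<in>I. ?A i / (x - l i)) - (\<Sum>i\<in>I. ?A i / (x - l i)) / (x - l a)
       + (\<Sum>i\<in>I. ?A i / (l a - l i)) / (x - l a)"
    by (simp add: sum.distrib sum_subtractf sum_divide_distrib)
  moreover have "frob_coeff (insert a I) l a / (x - l a) =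
      1 / (x - l a) - (\<Sum>i\<in>I. ?A i / (l a - l i)) / (x - l a)"
    using insert.hyps by (simp add: frob_coeff_insert_new IHa diff_divide_distrib)
  moreover have "(\<Prod>j\<in>insert a I. 1 - 1 / (x - l j)) =
      (1 - 1 / (x - l a)) * (1 - (\<Sum>i\<in>I. ?A i / (x - l i)))"
    using insert.hyps by (simp add: IHx)
  ultimately show ?case
    using insert.hyps by (simp add: left_diff_distrib right_diff_distrib)
qed

text \<open>These are the coefficients of 1/x and 1/x^2 in the expansion of
  \<open>prod_partial_fractions\<close> at infinity. The induction extracts them without any limit,
  by evaluating that identity at the new point \<open>l a\<close>.\<close>

lemma sum_frob_coeff:
  assumes "finite I" "inj_on l I"
  shows "(\<Sum>i\<in>I. frob_coeff I l i) = card I"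
    and "(\<Sum>i\<in>I. l i * frob_coeff I l i) = (\<Sum>i\<in>I. l i) - real (card I) * (real (card I) - 1) / 2"
proof -
  have "(\<Sum>i\<in>I. frob_coeff I l i) = card I \<and>
    (\<Sum>i\<in>I. l i * frob_coeff I l i) = (\<Sum>i\<in>I. l i) - real (card I) * (real (card I) - 1) / 2"
    using assms
  proof (induction I rule: finite_induct)
    case empty
    show ?case by simp
  next
    case (insert a I)
    let ?A = "frob_coeff I l"
    define s where "s = (\<Sum>i\<in>I. ?A i / (l a - l i))"
    have a: "\<And>i. i \<in> I \<Longrightarrow> l a \<noteq> l i" using insert by (auto simp: inj_on_def)
    have new: "frob_coeff (insert a I) l a = 1 - s"
      using insert prod_partial_fractions[of I l "l a"]
      by (auto simp: frob_coeff_insert_new s_def)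
    have 1: "frob_coeff (insert a I) l i = ?A i + ?A i / (l a - l i)" if "i \<in> I" for i
    proof -
      have *: "1 - 1 / (l i - l a) = 1 + 1 / (l a - l i)"
        using a[OF that] a[OF that, symmetric]
        by (simp add: divide_simps) (simp add: algebra_simps)
      show ?thesis
        unfolding frob_coeff_insert[OF insert.hyps(1,2) that] * by (simp add: ring_distribs)
    qed
    have 2: "l i * frob_coeff (insert a I) l i = l i * ?A i - ?A i + l a * (?A i / (l a - l i))"
      if "i \<in> I" for i
    proof -
      have "?A i * l i / (l a - l i) = - ?A i + l a * ?A i / (l a - l i)"
        using a[OF that] by (simp add: divide_simps) (simp add: algebra_simps)
      thus ?thesis by (simp add: 1[OF that] ring_distribs mult.commute)
    qed
    have IH: "(\<Sum>i\<in>I. ?A i) = card I"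
      "(\<Sum>i\<in>I. l i * ?A i) = (\<Sum>i\<in>I. l i) - real (card I) * (real (card I) - 1) / 2"
      using insert by auto
    have "(\<Sum>i\<in>I. frob_coeff (insert a I) l i) = card I + s"
      using 1 IH by (simp add: sum.distrib s_def)
    moreover have "(\<Sum>i\<in>I. l i * frob_coeff (insert a I) l i)
        = (\<Sum>i\<in>I. l i) - real (card I) * (real (card I) - 1) / 2 - card I + l a * s"
      using 2 IH by (simp add: sum.distrib sum_subtractf s_def sum_distrib_left)
    ultimately show ?case
      using insert.hyps by (simp add: new algebra_simps) (simp add: field_simps)
  qed
  thus "(\<Sum>i\<in>I. frob_coeff I l i) = card I"
    and "(\<Sum>i\<in>I. l i * frob_coeff I l i) = (\<Sum>i\<in>I. l i) - real (card I) * (real (card I) - 1) / 2"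
    by auto
qed

section \<open>Comparing the coefficients of two nearby rows\<close>

lemma sum_inverse_squares_le:
  assumes "finite (X :: int set)" "0 \<notin> X"
  shows "(\<Sum>x\<in>X. 1 / (real_of_int x)\<^sup>2) \<le> 4"
proof -
  have nat: "(\<Sum>m\<in>{1..n}. 1 / (real m)\<^sup>2) \<le> 2" for n :: nat
  proof -
    \<comment> \<open>The sharper bound makes the induction telescope; for \<open>n = 0\<close> it
      reads 2, since \<open>1 / 0 = 0\<close>.\<close>
    have "(\<Sum>m\<in>{1..n}. 1 / (real m)\<^sup>2) \<le> 2 - 1 / real n"
    proof (induction n)
      case (Suc n)
      have "1 / (real (Suc n))\<^sup>2 \<le> 1 / real n - 1 / (real n + 1)"
        if "n \<noteq> 0" using that by (simp add: divide_simps power2_eq_square) (simp add: algebra_simps)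
      thus ?case using Suc by (cases "n = 0") (auto simp: add_ac)
    qed simp
    thus ?thesis by (smt (verit) divide_nonneg_nonneg of_nat_0_le_iff)
  qed
  define n where "n = nat (Max (insert 0 (abs ` X)))"
  have sub: "X \<subseteq> int ` {1..n} \<union> (\<lambda>m. - int m) ` {1..n}"
  proof
    fix x assume x: "x \<in> X"
    hence "\<bar>x\<bar> \<le> Max (insert 0 (abs ` X))" using assms by (intro Max_ge) auto
    moreover have "x \<noteq> 0" using x assms by auto
    ultimately have m: "nat \<bar>x\<bar> \<in> {1..n}" by (auto simp: n_def)
    show "x \<in> int ` {1..n} \<union> (\<lambda>m. - int m) ` {1..n}"
    proof (cases "x \<ge> 0")
      case True
      thus ?thesis using m by (intro UnI1 image_eqI[of _ _ "nat \<bar>x\<bar>"]) auto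
    next
      case False
      thus ?thesis using m by (intro UnI2 image_eqI[of _ _ "nat \<bar>x\<bar>"]) auto
    qed
  qed
  have "(\<Sum>x\<in>X. 1 / (real_of_int x)\<^sup>2)
      \<le> (\<Sum>x\<in>int ` {1..n} \<union> (\<lambda>m. - int m) ` {1..n}. 1 / (real_of_int x)\<^sup>2)"
    by (intro sum_mono2 sub) auto
  also have "\<dots> \<le> (\<Sum>x\<in>int ` {1..n}. 1 / (real_of_int x)\<^sup>2)
      + (\<Sum>x\<in>(\<lambda>m. - int m) ` {1..n}. 1 / (real_of_int x)\<^sup>2)"
    by (simp add: sum_Un sum_nonneg)
  also have "\<dots> = (\<Sum>m\<in>{1..n}. 1 / (real m)\<^sup>2) + (\<Sum>m\<in>{1..n}. 1 / (real m)\<^sup>2)"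
    by (simp add: sum.reindex inj_on_def)
  finally show ?thesis using nat[of n] by simp
qed

text \<open>With \<open>d\<close>, \<open>d'\<close> the differences to \<open>l j\<close>, the
  quotient of corresponding factors is \<open>1 + (d' - d) / (d' * (d - 1))\<close>. Here
  \<open>\<bar>d' - d\<bar> \<le> K\<close>, and \<open>d'\<close> and \<open>d - 1\<close> run
  through distinct nonzero integers, so the sum of the errors is bounded independently of
  \<open>I\<close>: the exponent is at most K (4 + 4) / 2. The corner condition on \<open>i\<close>
  keeps \<open>d - 1\<close> away from 0.\<close>

lemma frob_coeff_ratio:
  fixes l :: "nat \<Rightarrow> int" and K :: nat
  assumes fin: "finite I" and inj: "inj_on l I" and i: "i \<in> I" "i' \<in> I" "i \<noteq> i'"
    and corner: "\<And>j. j \<in> I \<Longrightarrow> l i - l j \<noteq> 1" and close: "\<bar>l i - l i'\<bar> \<le> int K"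
  shows "frob_coeff I (real_of_int \<circ> l) i' \<le> 4 * exp (4 * K) * frob_coeff I (real_of_int \<circ> l) i"
proof -
  define J where "J = I - {i, i'}"
  define d where "d j = real_of_int (l i - l j)" for j
  define d' where "d' j = real_of_int (l i' - l j)" for j
  have J: "I - {i} - {i'} = J" "I - {i'} - {i} = J" by (auto simp: J_def)
  have finJ: "finite J" using fin by (simp add: J_def)
  have ints: "1 - 1 / real_of_int z \<ge> 1 / 2" if "z \<noteq> 0" "z \<noteq> 1" for z
  proof (cases "z \<ge> 2")
    case True
    hence "real_of_int z \<ge> 2" by linarith
    thus ?thesis by (simp add: field_simps)
  next
    case False
    hence "real_of_int z < 0" using that by linarith
    thus ?thesis by (simp add: field_simps)
  qed
  have ints0: "1 - 1 / real_of_int z \<ge> 0" if "z \<noteq> 0" for z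
    using ints[of z] that by (cases "z = 1") auto
  have ints2: "1 - 1 / real_of_int z \<le> 2" if "z \<noteq> 0" for z
  proof (cases "z \<ge> 1")
    case False
    hence "real_of_int z \<le> -1" using that by linarith
    thus ?thesis by (simp add: field_simps)
  qed (simp add: field_simps)
  have nz: "l i - l j \<noteq> 0" "l i - l j \<noteq> 1" "l i' - l j \<noteq> 0" if "j \<in> J" for j
    using that inj i corner[of j] by (auto simp: J_def inj_on_def)
  have ii': "l i - l i' \<noteq> 0" "l i - l i' \<noteq> 1" "l i' - l i \<noteq> 0"
    using inj i corner[of i'] by (auto simp: inj_on_def)
  have A: "frob_coeff I (real_of_int \<circ> l) i = (1 - 1 / d i') * (\<Prod>j\<in>J. 1 - 1 / d j)"
    using fin i prod.remove[of "I - {i}" i' "\<lambda>j. 1 - 1 / d j"]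
    by (simp add: frob_coeff_def d_def J)
  have A': "frob_coeff I (real_of_int \<circ> l) i' = (1 - 1 / d' i) * (\<Prod>j\<in>J. 1 - 1 / d' j)"
    using fin i prod.remove[of "I - {i'}" i "\<lambda>j. 1 - 1 / d' j"]
    by (simp add: frob_coeff_def d'_def J)
  have factor: "1 - 1 / d' j \<le> (1 - 1 / d j) * exp (K * ((1 / (d' j)\<^sup>2 + 1 / (d j - 1)\<^sup>2) / 2))"
    if j: "j \<in> J" for j
  proof -
    have dz: "d j \<noteq> 0" "d j - 1 \<noteq> 0" "d' j \<noteq> 0"
      using nz[OF j] by (auto simp: d_def d'_def)
    have pos: "1 - 1 / d j > 0"
      using ints[of "l i - l j"] nz[OF j] by (simp add: d_def)
    have "\<bar>d' j - d j\<bar> \<le> K"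
      using close by (simp add: d_def d'_def)
    hence "(d' j - d j) / (d' j * (d j - 1)) \<le> K * (1 / (\<bar>d' j\<bar> * \<bar>d j - 1\<bar>))"
    proof -
      have "(d' j - d j) / (d' j * (d j - 1)) \<le> \<bar>(d' j - d j) / (d' j * (d j - 1))\<bar>"
        by (rule abs_ge_self)
      also have "\<dots> = \<bar>d' j - d j\<bar> * (1 / (\<bar>d' j\<bar> * \<bar>d j - 1\<bar>))"
        by (simp add: abs_mult)
      also have "\<dots> \<le> K * (1 / (\<bar>d' j\<bar> * \<bar>d j - 1\<bar>))"
        using \<open>\<bar>d' j - d j\<bar> \<le> K\<close> by (intro mult_right_mono) auto
      finally show ?thesis .
    qed
    also have "\<dots> \<le> K * ((1 / (d' j)\<^sup>2 + 1 / (d j - 1)\<^sup>2) / 2)"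
    proof (intro mult_left_mono)
      have "0 \<le> (1 / \<bar>d' j\<bar> - 1 / \<bar>d j - 1\<bar>)\<^sup>2" by simp
      thus "1 / (\<bar>d' j\<bar> * \<bar>d j - 1\<bar>) \<le> (1 / (d' j)\<^sup>2 + 1 / (d j - 1)\<^sup>2) / 2"
        by (simp add: power2_diff power_divide field_simps)
    qed simp
    finally have le: "(d' j - d j) / (d' j * (d j - 1)) \<le> K * ((1 / (d' j)\<^sup>2 + 1 / (d j - 1)\<^sup>2) / 2)" .
    have "1 - 1 / d' j = (1 - 1 / d j) * (1 + (d' j - d j) / (d' j * (d j - 1)))"
      using dz by (simp add: divide_simps) (simp add: algebra_simps)
    also have "\<dots> \<le> (1 - 1 / d j) * exp ((d' j - d j) / (d' j * (d j - 1)))"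
      using pos by (intro mult_left_mono exp_ge_add_one_self) auto
    also have "\<dots> \<le> (1 - 1 / d j) * exp (K * ((1 / (d' j)\<^sup>2 + 1 / (d j - 1)\<^sup>2) / 2))"
      using pos le by (intro mult_left_mono) auto
    finally show ?thesis .
  qed
  have sq: "(\<Sum>j\<in>J. 1 / (d' j)\<^sup>2) \<le> 4" "(\<Sum>j\<in>J. 1 / (d j - 1)\<^sup>2) \<le> 4"
  proof -
    have inj': "inj_on (\<lambda>j. l i' - l j) J" "inj_on (\<lambda>j. l i - l j - 1) J"
      using inj by (auto simp: inj_on_def J_def)
    have "0 \<notin> (\<lambda>j. l i' - l j) ` J" "0 \<notin> (\<lambda>j. l i - l j - 1) ` J"
      using nz by force+
    note * = this[THEN sum_inverse_squares_le[rotated]]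
    show "(\<Sum>j\<in>J. 1 / (d' j)\<^sup>2) \<le> 4" "(\<Sum>j\<in>J. 1 / (d j - 1)\<^sup>2) \<le> 4"
      using * finJ by (simp_all add: sum.reindex inj' d_def d'_def)
  qed
  have P0: "(\<Prod>j\<in>J. 1 - 1 / d j) \<ge> 0"
    unfolding d_def using nz(1) by (intro prod_nonneg ints0)
  have P0': "(\<Prod>j\<in>J. 1 - 1 / d' j) \<ge> 0"
    unfolding d'_def using nz(3) by (intro prod_nonneg ints0)
  have "(\<Prod>j\<in>J. 1 - 1 / d' j)
      \<le> (\<Prod>j\<in>J. (1 - 1 / d j) * exp (K * ((1 / (d' j)\<^sup>2 + 1 / (d j - 1)\<^sup>2) / 2)))"
    using factor nz(3) ints0 by (intro prod_mono) (auto simp only: d'_def)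
  also have "\<dots> = (\<Prod>j\<in>J. 1 - 1 / d j)
      * exp (K * (((\<Sum>j\<in>J. 1 / (d' j)\<^sup>2) + (\<Sum>j\<in>J. 1 / (d j - 1)\<^sup>2)) / 2))"
    by (simp add: prod.distrib exp_sum[symmetric] finJ sum_distrib_left[symmetric]
        sum_divide_distrib[symmetric] sum.distrib)
  also have "\<dots> \<le> (\<Prod>j\<in>J. 1 - 1 / d j) * exp (4 * K)"
  proof -
    have "K * (((\<Sum>j\<in>J. 1 / (d' j)\<^sup>2) + (\<Sum>j\<in>J. 1 / (d j - 1)\<^sup>2)) / 2) \<le> real K * 4"
      using sq by (intro mult_left_mono) auto
    thus ?thesis using P0 by (intro mult_left_mono) auto
  qed
  finally have main: "(\<Prod>j\<in>J. 1 - 1 / d' j) \<le> (\<Prod>j\<in>J. 1 - 1 / d j) * exp (4 * K)" .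
  \<comment> \<open>The leading 4 comes from the two factors that pair \<open>i\<close> with
    \<open>i'\<close>: one is at most 2, the other at least 1/2.\<close>
  have "frob_coeff I (real_of_int \<circ> l) i' \<le> 2 * ((\<Prod>j\<in>J. 1 - 1 / d j) * exp (4 * K))"
    unfolding A' using ints2[of "l i' - l i"] ii' main P0' by (intro mult_mono) (auto simp: d'_def)
  also have "\<dots> \<le> 4 * exp (4 * K) * ((1 - 1 / d i') * (\<Prod>j\<in>J. 1 - 1 / d j))"
  proof -
    have "1 / 2 * (\<Prod>j\<in>J. 1 - 1 / d j) \<le> (1 - 1 / d i') * (\<Prod>j\<in>J. 1 - 1 / d j)"
      using ints[of "l i - l i'"] ii' P0 by (intro mult_right_mono) (auto simp: d_def)
    hence "4 * exp (4 * K) * (1 / 2 * (\<Prod>j\<in>J. 1 - 1 / d j))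
        \<le> 4 * exp (4 * K) * ((1 - 1 / d i') * (\<Prod>j\<in>J. 1 - 1 / d j))"
      by (intro mult_left_mono) auto
    thus ?thesis by (simp add: mult_ac)
  qed
  finally show ?thesis unfolding A .
qed

section \<open>Counting removal orders of a Young diagram\<close>

definition is_partition :: "nat \<Rightarrow> (nat \<Rightarrow> nat) \<Rightarrow> bool" where
  "is_partition n r \<longleftrightarrow> (\<forall>i\<ge>1. r (Suc i) \<le> r i) \<and> (\<forall>i>n. r i = 0)"

text \<open>The beta-numbers, strictly decreasing in \<open>j\<close>. Empty rows are included, so
  the index set {1..n} stays fixed while boxes disappear. Integer values make differences exact and
  permit the inverse-square bound.\<close>

definition beta :: "nat \<Rightarrow> (nat \<Rightarrow> nat) \<Rightarrow> nat \<Rightarrow> int" where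
  "beta n r j = int (r j) + int n - int j"

definition remove_corner :: "(nat \<Rightarrow> nat) \<Rightarrow> nat \<Rightarrow> nat \<Rightarrow> nat" where
  "remove_corner r i = r(i := r i - 1)"

definition corner_rows :: "nat \<Rightarrow> (nat \<Rightarrow> nat) \<Rightarrow> nat set" where
  "corner_rows n r = {i\<in>{1..n}. r (Suc i) < r i}"

lemma partition_antimono:
  assumes "is_partition n r" "1 \<le> i" "i \<le> j"
  shows "r j \<le> r i"
  using assms(3)
proof (induction j rule: dec_induct)
  case (step m)
  thus ?case using assms(1,2) le_trans[of "r (Suc m)" "r m"] by (auto simp: is_partition_def)
qed simp

lemma beta_strict_antimono:
  assumes "is_partition n r" "1 \<le> i" "i < j"
  shows "beta n r j < beta n r i"
  using partition_antimono[of n r i j] assms by (simp add: beta_def)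

lemma inj_on_beta:
  assumes "is_partition n r"
  shows "inj_on (beta n r) {1..n}"
proof (rule linorder_inj_onI)
  show "beta n r x \<noteq> beta n r y" if "x < y" "x \<in> {1..n}" "y \<in> {1..n}" for x y
    using beta_strict_antimono[OF assms, of x y] that by auto
qed auto

lemma partition_diagram_decomp:
  assumes "is_partition n r"
  shows "young_diagram r = (SIGMA i:{1..n}. {1..r i})"
proof -
  have "i \<le> n" if "1 \<le> j" "j \<le> r i" for i j
    using that assms by (rule_tac ccontr) (auto simp: is_partition_def)
  thus ?thesis by (force simp: young_diagram_def)
qed

lemma finite_young_diagram: "is_partition n r \<Longrightarrow> finite (young_diagram r)"
  by (simp add: partition_diagram_decomp)

lemma card_young_diagram: "is_partition n r \<Longrightarrow> card (young_diagram r) = (\<Sum>i=1..n. r i)"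
  by (simp add: partition_diagram_decomp)

lemma maximals_young_diagram:
  assumes "is_partition n r"
  shows "maximals (young_diagram r) = (\<lambda>i. (i, r i)) ` corner_rows n r"
proof (intro set_eqI iffI)
  fix x assume x: "x \<in> maximals (young_diagram r)"
  obtain i j where ij: "x = (i, j)" by (cases x)
  have mem: "1 \<le> i" "1 \<le> j" "j \<le> r i"
    using x by (auto simp: maximals_def young_diagram_def ij)
  have max: "k = i \<and> l = j" if "1 \<le> k" "1 \<le> l" "l \<le> r k" "i \<le> k" "j \<le> l" for k l
  proof -
    have "(k, l) \<in> young_diagram r" "x \<le> (k, l)"
      using that by (auto simp: young_diagram_def ij)
    hence "(k, l) = x" using x by (auto simp only: maximals_def)
    thus ?thesis by (simp add: ij)
  qed
  have "j = r i" using max[of i "r i"] mem by auto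
  moreover have "r (Suc i) < r i"
    using max[of "Suc i" "r i"] mem \<open>j = r i\<close> by (intro not_le_imp_less) auto
  moreover have "i \<le> n"
    using mem assms by (rule_tac ccontr) (auto simp: is_partition_def)
  ultimately show "x \<in> (\<lambda>i. (i, r i)) ` corner_rows n r"
    using mem ij by (auto simp: corner_rows_def)
next
  fix x assume "x \<in> (\<lambda>i. (i, r i)) ` corner_rows n r"
  then obtain i where i: "x = (i, r i)" "1 \<le> i" "r (Suc i) < r i"
    by (auto simp: corner_rows_def)
  have "(k, l) = x" if kl: "(k, l) \<in> young_diagram r" "x \<le> (k, l)" for k l
  proof -
    have "i \<le> k" "r i \<le> l" "l \<le> r k" using kl by (auto simp: young_diagram_def i)
    moreover from this have "k = i"
      using partition_antimono[OF assms, of "Suc i" k] i by (rule_tac ccontr) auto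
    ultimately show ?thesis using i by simp
  qed
  moreover have "x \<in> young_diagram r" using i by (simp add: young_diagram_def)
  ultimately show "x \<in> maximals (young_diagram r)"
    by (auto simp: maximals_def)
qed

lemma remove_corner_diagram:
  assumes "is_partition n r" "i \<in> corner_rows n r"
  shows "young_diagram r - {(i, r i)} = young_diagram (remove_corner r i)"
  using assms
  by (auto simp: young_diagram_def remove_corner_def corner_rows_def split: if_splits)

lemma remove_corner_partition:
  assumes "is_partition n r" "i \<in> corner_rows n r"
  shows "is_partition n (remove_corner r i)"
proof -
  have "remove_corner r i (Suc j) \<le> remove_corner r i j" if "j \<ge> 1" for j
  proof -
    have "r (Suc j) \<le> r j" "r (Suc i) < r i"
      using assms that by (auto simp: is_partition_def corner_rows_def)
    thus ?thesis by (auto simp: remove_corner_def)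
  qed
  thus ?thesis using assms by (auto simp: is_partition_def remove_corner_def)
qed

lemma sum_remove_corner:
  assumes "i \<in> corner_rows n r"
  shows "(\<Sum>j=1..n. r j) = Suc (\<Sum>j=1..n. remove_corner r i j)"
proof -
  have i: "i \<in> {1..n}" "r i > 0" using assms by (auto simp: corner_rows_def)
  have "(\<Sum>j\<in>{1..n} - {i}. remove_corner r i j) = (\<Sum>j\<in>{1..n} - {i}. r j)"
    by (intro sum.cong) (auto simp: remove_corner_def)
  moreover have "remove_corner r i i = r i - 1" by (simp add: remove_corner_def)
  ultimately show ?thesis using i(2) by (simp only: sum.remove[OF finite_atLeastAtMost i(1)])
qed

abbreviation corner_weight :: "nat \<Rightarrow> (nat \<Rightarrow> nat) \<Rightarrow> nat \<Rightarrow> real" where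
  "corner_weight n r i \<equiv> real_of_int (beta n r i) * frob_coeff {1..n} (real_of_int \<circ> beta n r) i"

text \<open>If the next row has equal length, the factor belonging to it is zero; if
  \<open>i = n\<close>, the row is empty and \<open>beta n r n = 0\<close>. So sums over corners
  extend to all rows, where \<open>sum_frob_coeff\<close> applies.\<close>

lemma corner_weight_noncorner:
  assumes "is_partition n r" "i \<in> {1..n} - corner_rows n r"
  shows "corner_weight n r i = 0"
proof (cases "i = n")
  case True
  moreover have "r (Suc n) = 0" using assms by (simp add: is_partition_def)
  ultimately have "beta n r i = 0" using assms by (auto simp: corner_rows_def beta_def)
  thus ?thesis by simp
next
  case False
  have "r (Suc i) = r i" using assms by (force simp: is_partition_def corner_rows_def)
  hence "beta n r i - beta n r (Suc i) = 1" by (simp add: beta_def)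
  hence "1 - 1 / (real_of_int (beta n r i) - real_of_int (beta n r (Suc i))) = 0"
    by (metis diff_self div_by_1 of_int_1 of_int_diff)
  moreover have "Suc i \<in> {1..n} - {i}" using False assms by auto
  ultimately have "frob_coeff {1..n} (real_of_int \<circ> beta n r) i = 0"
    by (auto simp: frob_coeff_def intro!: prod_zero)
  thus ?thesis by simp
qed

text \<open>The removal probabilities add up to 1: the correction n (n - 1) / 2 in
  \<open>sum_frob_coeff\<close> equals the sum of the shifts n - i built into
  \<open>beta\<close>.\<close>

lemma sum_corner_weight:
  assumes "is_partition n r"
  shows "(\<Sum>i\<in>corner_rows n r. corner_weight n r i) = (\<Sum>i=1..n. r i)"
proof -
  have "(\<Sum>i\<in>corner_rows n r. corner_weight n r i) = (\<Sum>i=1..n. corner_weight n r i)"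
    using corner_weight_noncorner[OF assms]
    by (intro sum.mono_neutral_left) (auto simp: corner_rows_def)
  also have "\<dots> = (\<Sum>i=1..n. real_of_int (beta n r i)) - real n * (real n - 1) / 2"
  proof -
    have "inj_on (real_of_int \<circ> beta n r) {1..n}"
      by (intro comp_inj_on inj_on_beta[OF assms] inj_onI) simp
    from sum_frob_coeff(2)[OF finite_atLeastAtMost this] show ?thesis by simp
  qed
  also have "(\<Sum>i=1..n. real_of_int (beta n r i)) =
      (\<Sum>i=1..n. real (r i)) + (real n * real n - (\<Sum>i=1..n. real i))"
    by (simp add: beta_def sum.distrib sum_subtractf)
  also have "(\<Sum>i=1..n. real i) = real n * (real n + 1) / 2"
    using double_gauss_sum_from_Suc_0[of n, where 'a = real] by simp
  also have "real n * real n - real n * (real n + 1) / 2 = real n * (real n - 1) / 2"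
    by (simp add: field_simps)
  finally show ?thesis by (simp add: comp_def)
qed

section \<open>The Frobenius product formula\<close>

definition index_pairs :: "nat \<Rightarrow> (nat \<times> nat) set" where
  "index_pairs n = {(a, b). 1 \<le> a \<and> a < b \<and> b \<le> n}"

text \<open>The Frobenius form of the hook length formula, without the factorial of the number of
  boxes.\<close>

definition frobenius :: "nat \<Rightarrow> (nat \<Rightarrow> nat) \<Rightarrow> real" where
  "frobenius n r = (\<Prod>(a, b)\<in>index_pairs n. real_of_int (beta n r a - beta n r b)) /
     (\<Prod>a=1..n. fact (r a + n - a))"

lemma finite_index_pairs: "finite (index_pairs n)"
  by (rule finite_subset[of _ "{..n} \<times> {..n}"]) (auto simp: index_pairs_def)

lemma frobenius_nonzero:
  assumes "is_partition n r"
  shows "frobenius n r \<noteq> 0"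
proof -
  have "beta n r a \<noteq> beta n r b" if "(a, b) \<in> index_pairs n" for a b
    using beta_strict_antimono[OF assms, of a b] that by (auto simp: index_pairs_def)
  thus ?thesis using finite_index_pairs by (auto simp: frobenius_def)
qed

lemma frobenius_remove_corner:
  assumes r: "is_partition n r" and i: "i \<in> corner_rows n r"
  shows "frobenius n (remove_corner r i) = corner_weight n r i * frobenius n r"
proof -
  define l where "l j = real_of_int (beta n r j)" for j
  define l' where "l' j = real_of_int (beta n (remove_corner r i) j)" for j
  define q where "q = (\<lambda>(a, b). (l' a - l' b) / (l a - l b))"
  have i': "i \<in> {1..n}" "r i > 0" using i by (auto simp: corner_rows_def)
  have l': "l' j = (if j = i then l i - 1 else l j)" for j
    using i' by (simp add: l'_def l_def beta_def remove_corner_def)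
  have neq: "l a \<noteq> l b" if "a \<in> {1..n}" "b \<in> {1..n}" "a \<noteq> b" for a b
    using inj_onD[OF inj_on_beta[OF r], of a b] that by (auto simp: l_def)
  have 1: "(\<Prod>(a, b)\<in>index_pairs n. l' a - l' b) =
      (\<Prod>p\<in>index_pairs n. q p) * (\<Prod>(a, b)\<in>index_pairs n. l a - l b)"
    unfolding prod.distrib[symmetric]
  proof (intro prod.cong refl)
    fix p assume p: "p \<in> index_pairs n"
    obtain a b where ab: "p = (a, b)" by (cases p)
    have "l a - l b \<noteq> 0" using neq[of a b] p by (auto simp: ab index_pairs_def)
    thus "(case p of (a, b) \<Rightarrow> l' a - l' b) = q p * (case p of (a, b) \<Rightarrow> l a - l b)"
      by (simp add: ab q_def)
  qed
  \<comment> \<open>Only pairs containing \<open>i\<close> change. They are indexed by their other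
    member \<open>j\<close>, with \<open>min\<close> and \<open>max\<close> restoring the order of
    the pair.\<close>
  have "(\<Prod>p\<in>index_pairs n. q p) = (\<Prod>p\<in>(\<lambda>j. (min i j, max i j)) ` ({1..n} - {i}). q p)"
  proof (intro prod.mono_neutral_right ballI finite_index_pairs)
    show "(\<lambda>j. (min i j, max i j)) ` ({1..n} - {i}) \<subseteq> index_pairs n"
      using i' by (auto simp: index_pairs_def min_def max_def)
    fix p assume p: "p \<in> index_pairs n - (\<lambda>j. (min i j, max i j)) ` ({1..n} - {i})"
    obtain a b where ab: "p = (a, b)" by (cases p)
    have range: "1 \<le> a" "a < b" "b \<le> n"
      and notin: "\<And>j. j \<in> {1..n} - {i} \<Longrightarrow> (a, b) \<noteq> (min i j, max i j)"
      using p by (auto simp: ab index_pairs_def)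
    have "a \<noteq> i" "b \<noteq> i"
      using notin[of b] notin[of a] range by auto
    thus "q p = 1"
      using p neq[of a b] by (auto simp: ab q_def l' index_pairs_def)
  qed
  also have "\<dots> = (\<Prod>j\<in>{1..n} - {i}. q (min i j, max i j))"
    by (subst prod.reindex) (auto simp: inj_on_def min_def max_def split: if_splits)
  also have "\<dots> = frob_coeff {1..n} l i"
    unfolding frob_coeff_def
  proof (intro prod.cong refl)
    fix j assume j: "j \<in> {1..n} - {i}"
    have "l i \<noteq> l j" "l j \<noteq> l i" using j neq[of i j] i' by auto
    thus "q (min i j, max i j) = 1 - 1 / (l i - l j)"
      using j by (auto simp: q_def l' min_def max_def divide_simps algebra_simps)
  qed
  finally have 2: "(\<Prod>p\<in>index_pairs n. q p) = frob_coeff {1..n} l i" .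
  have "(\<Prod>a\<in>{1..n} - {i}. fact (remove_corner r i a + n - a) :: real) =
      (\<Prod>a\<in>{1..n} - {i}. fact (r a + n - a))"
    by (intro prod.cong) (auto simp: remove_corner_def)
  moreover have "(fact (r i + n - i) :: real) = l i * fact (remove_corner r i i + n - i)"
  proof -
    have "r i + n - i = Suc (remove_corner r i i + n - i)"
      using i' by (auto simp: remove_corner_def)
    moreover have "l i = real (r i + n - i)"
      using i' by (simp add: l_def beta_def of_nat_diff)
    ultimately show ?thesis by (metis fact_Suc of_nat_fact of_nat_mult)
  qed
  ultimately have 3: "(\<Prod>a=1..n. fact (r a + n - a) :: real) =
      l i * (\<Prod>a=1..n. fact (remove_corner r i a + n - a))"
    by (simp only: prod.remove[OF finite_atLeastAtMost i'(1)] mult.assoc)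
  have "l i \<noteq> 0" using i' by (auto simp: l_def beta_def)
  thus ?thesis
    using 1 2 3 by (simp add: frobenius_def l_def[symmetric] l'_def[symmetric] comp_def)
qed

text \<open>
  The product \<open>frobenius n (\<lambda>_. 0)\<close> equals 1; keeping it as a normalising factor makes the induction
  base trivial.
\<close>

theorem card_removal_orders_frobenius:
  assumes "is_partition n r"
  shows "card (removal_orders (young_diagram r)) * frobenius n (\<lambda>_. 0) =
    fact (\<Sum>i=1..n. r i) * frobenius n r"
  using assms
proof (induction "\<Sum>i=1..n. r i" arbitrary: r)
  case (0 r)
  hence "r i = 0" if "i \<in> {1..n}" for i using that by auto
  hence "frobenius n r = frobenius n (\<lambda>_. 0)"
    unfolding frobenius_def beta_def
    by (intro arg_cong2[of _ _ _ _ "(/)"] prod.cong) (auto simp: index_pairs_def)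
  moreover have "young_diagram r = {}"
    using 0 by (auto simp: partition_diagram_decomp[OF 0(2)])
  ultimately show ?case using 0(1)[symmetric] by simp
next
  case (Suc m r)
  note r = \<open>is_partition n r\<close>
  have ne: "young_diagram r \<noteq> {}"
    using card_young_diagram[OF r] Suc.hyps(2) by auto
  let ?F = "frobenius n (\<lambda>_. 0)"
  have "card (removal_orders (young_diagram r)) * ?F =
      (\<Sum>i\<in>corner_rows n r. card (removal_orders (young_diagram r - {(i, r i)})) * ?F)"
    using card_removal_orders[OF finite_young_diagram[OF r] ne]
    by (simp add: maximals_young_diagram[OF r] sum.reindex inj_on_def sum_distrib_right)
  also have "\<dots> = (\<Sum>i\<in>corner_rows n r. fact m * (corner_weight n r i * frobenius n r))"
  proof (intro sum.cong refl)
    fix i assume i: "i \<in> corner_rows n r"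
    have m: "m = (\<Sum>j=1..n. remove_corner r i j)"
      using sum_remove_corner[OF i] Suc.hyps(2) by simp
    show "card (removal_orders (young_diagram r - {(i, r i)})) * ?F =
        fact m * (corner_weight n r i * frobenius n r)"
      using Suc.hyps(1)[OF m remove_corner_partition[OF r i]]
      by (simp only: remove_corner_diagram[OF r i] frobenius_remove_corner[OF r i] m)
  qed
  also have "\<dots> = fact m * (\<Sum>i\<in>corner_rows n r. corner_weight n r i) * frobenius n r"
    by (simp add: sum_distrib_left sum_distrib_right mult_ac)
  also have "\<dots> = fact m * real (Suc m) * frobenius n r"
    using sum_corner_weight[OF r] Suc.hyps(2) by simp
  finally show ?case using Suc.hyps(2)[symmetric] by (simp add: mult.commute)
qed

text \<open>The removal probability as \<open>corner_weight\<close> over the number of boxes; the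
  normalising factor cancels because it is nonzero.\<close>

corollary card_removal_orders_corner:
  assumes r: "is_partition n r" and i: "i \<in> corner_rows n r"
  shows "real (card (young_diagram r)) * card (removal_orders (young_diagram r - {(i, r i)})) =
    corner_weight n r i * card (removal_orders (young_diagram r))"
proof -
  let ?F = "frobenius n (\<lambda>_. 0)"
  define m where "m = (\<Sum>j=1..n. remove_corner r i j)"
  have F: "?F \<noteq> 0" by (rule frobenius_nonzero) (simp add: is_partition_def)
  have "real (card (young_diagram r)) * card (removal_orders (young_diagram r - {(i, r i)})) * ?F =
      real (Suc m) * (fact m * (corner_weight n r i * frobenius n r))"
    using card_removal_orders_frobenius[OF remove_corner_partition[OF r i]]
    unfolding remove_corner_diagram[OF r i] frobenius_remove_corner[OF r i]
        card_young_diagram[OF r] sum_remove_corner[OF i] m_def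
    by (simp only: of_nat_mult mult.assoc)
  also have "\<dots> = corner_weight n r i * (fact (Suc m) * frobenius n r)"
    by (simp add: algebra_simps)
  also have "\<dots> = corner_weight n r i * card (removal_orders (young_diagram r)) * ?F"
    using card_removal_orders_frobenius[OF r]
    unfolding sum_remove_corner[OF i] m_def by (simp only: mult.assoc)
  finally show ?thesis using F by simp
qed

section \<open>Estimates for the removal probabilities\<close>

lemma prod_telescope_up:
  fixes k :: nat
  assumes "1 \<le> i"
  shows "(\<Prod>m\<in>{1..<i}. (2 * real m + k + 2) / (2 * real m + k)) = (2 * real i + k) / (k + 2)"
  using assms
proof (induction i rule: dec_induct)
  case base
  show ?case by simp
next
  case (step i)
  have "2 * real i + k \<noteq> 0" using step.hyps by linarith
  thus ?case using step by (simp add: field_simps)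
qed

text \<open>For m \<le> k the telescoping factor can have a nonpositive numerator or denominator;
  1/4, the square of the crude bound 1/2, takes its place.\<close>

lemma prod_telescope_down:
  fixes k :: nat
  assumes "1 \<le> k" "k \<le> M"
  shows "(\<Prod>m\<in>{1..M}. if m \<le> k then 1 / 4 else (2 * real m - k - 2) / (2 * real m - k)) =
    (1 / 4) ^ k * (k / (2 * real M - k))"
  using assms(2)
proof (induction M rule: dec_induct)
  case base
  show ?case using assms(1) by simp
next
  case (step M)
  let ?g = "\<lambda>m. if m \<le> k then 1 / 4 else (2 * real m - k - 2) / (2 * real m - k)"
  have pos: "2 * real M - k > 0" using step.hyps assms(1) by linarith
  have "(\<Prod>m\<in>{1..Suc M}. ?g m) = (1 / 4) ^ k * (k / (2 * real M - k)) * ?g (Suc M)"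
    using step.IH by simp
  also have "?g (Suc M) = (2 * real M - k) / (2 * real (Suc M) - k)"
    using step.hyps by simp
  finally show ?case using pos by simp
qed

text \<open>
  In the staircase \<open>l i - l j = 2 (j - i)\<close>. The factors with \<open>j < i\<close> and those with
  \<open>j > i\<close> multiply to order \<open>sqrt i\<close> and \<open>1 / sqrt (n - i)\<close>; squaring makes the products telescope.
\<close>

lemma frob_coeff_lower:
  assumes r: "is_partition n r" and stair: "\<And>j. j \<in> {1..n} \<Longrightarrow> r j \<le> n - j"
    and i: "i \<in> corner_rows n r" and k: "k \<ge> 2"
    and deep: "n \<le> r i + i + k" and bulk: "n \<le> 3 * i" "i + k \<le> n"
  shows "frob_coeff {1..n} (real_of_int \<circ> beta n r) i \<ge> (1 / 2) ^ k / 3"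
proof -
  define l where "l j = real_of_int (beta n r j)" for j
  define f where "f j = 1 - 1 / (l i - l j)" for j
  have i': "i \<in> {1..n}" "r (Suc i) < r i" using i by (auto simp: corner_rows_def)
  \<comment> \<open>The full staircase has \<open>l j = 2 * (n - j)\<close>. Row \<open>i\<close>
    falls short of this by at most \<open>k\<close> and no row exceeds it, so each difference moves
    by at most \<open>k\<close> in the unfavourable direction.\<close>
  have li: "l i \<ge> 2 * (real n - real i) - k"
    using deep by (simp add: l_def beta_def)
  have lj: "l j \<le> 2 * (real n - real j)" if "j \<in> {1..n}" for j
    using stair[OF that] that by (simp add: l_def beta_def le_diff_conv2)
  have up: "f j \<ge> 0" "(f j)\<^sup>2 \<ge> (2 * real (i - j) + k + 2) / (2 * real (i - j) + k)"
    if j: "j \<in> {1..<i}" for j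
  proof -
    have pos: "l j - l i > 0"
      using beta_strict_antimono[OF r, of j i] j by (simp add: l_def)
    have le: "l j - l i \<le> 2 * real (i - j) + k"
      using li lj[of j] i' j by (simp add: of_nat_diff)
    have "f j = 1 + 1 / (l j - l i)"
      using pos by (simp add: f_def divide_simps algebra_simps)
    also have "\<dots> \<ge> 1 + 1 / (2 * real (i - j) + k)"
      using pos le by (intro add_left_mono divide_left_mono) auto
    finally have ge: "f j \<ge> 1 + 1 / (2 * real (i - j) + k)" .
    have "1 + 1 / (2 * real (i - j) + k) \<ge> 0" by (intro add_nonneg_nonneg) auto
    with ge show "f j \<ge> 0" by linarith
    define c where "c = 2 * real (i - j) + k"
    have c: "c > 0" using k by (simp add: c_def)
    have "(f j)\<^sup>2 \<ge> (1 + 1 / c)\<^sup>2"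
      using ge \<open>1 + 1 / _ \<ge> 0\<close> unfolding c_def by (intro power_mono)
    moreover have "(1 + 1 / c)\<^sup>2 \<ge> (c + 2) / c"
      using c by (simp add: power2_eq_square field_simps)
    ultimately show "(f j)\<^sup>2 \<ge> (2 * real (i - j) + k + 2) / (2 * real (i - j) + k)"
      by (simp add: c_def)
  qed
  have down: "f j \<ge> 0" "(f j)\<^sup>2 \<ge> (let m = j - i in if m \<le> k then 1 / 4
      else (2 * real m - k - 2) / (2 * real m - k))"
    if j: "j \<in> {i<..n}" for j
  proof -
    \<comment> \<open>Since \<open>i\<close> is a corner, all later rows are strictly shorter. This
      gives a difference of at least 2 even where the staircase comparison \<open>v\<close> below is
      too weak.\<close>
    have "r j \<le> r (Suc i)" using partition_antimono[OF r, of "Suc i" j] j by auto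
    hence v2: "l i - l j \<ge> 2" using i' j by (simp add: l_def beta_def)
    have v: "l i - l j \<ge> 2 * real (j - i) - k"
      using li lj[of j] i' j by (simp add: of_nat_diff)
    have half: "f j \<ge> 1 / 2" using v2 by (simp add: f_def field_simps)
    thus "f j \<ge> 0" by simp
    have quarter: "(f j)\<^sup>2 \<ge> 1 / 4"
      using power_mono[OF half, of 2] by (simp add: power2_eq_square)
    have tele: "(f j)\<^sup>2 \<ge> (c - 2) / c" if c: "c > 0" "c \<le> l i - l j" for c
    proof -
      have "(c - 2) / c \<le> 1 - 2 / (l i - l j)"
        using c by (simp add: field_simps)
      also have "\<dots> \<le> (1 - 1 / v)\<^sup>2" if "v = l i - l j" for v
      proof -
        have "(1 - 1 / v)\<^sup>2 = 1 - 2 / v + (1 / v)\<^sup>2"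
          by (simp add: power2_eq_square algebra_simps)
        thus ?thesis using that by simp
      qed
      from this[OF refl] have "1 - 2 / (l i - l j) \<le> (f j)\<^sup>2"
        by (simp add: f_def)
      finally show ?thesis .
    qed
    show "(f j)\<^sup>2 \<ge> (let m = j - i in if m \<le> k then 1 / 4
      else (2 * real m - k - 2) / (2 * real m - k))"
    proof (cases "j - i \<le> k")
      case False
      hence "2 * real (j - i) - k > 0" using k by linarith
      thus ?thesis using tele[OF _ v] False by (simp add: Let_def algebra_simps)
    qed (use quarter in simp)
  qed
  have "(\<Prod>j\<in>{1..<i}. (f j)\<^sup>2) \<ge>
      (\<Prod>j\<in>{1..<i}. (2 * real (i - j) + k + 2) / (2 * real (i - j) + k))"
    using up by (intro prod_mono) auto
  also have "(\<Prod>j\<in>{1..<i}. (2 * real (i - j) + k + 2) / (2 * real (i - j) + k)) =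
      (\<Prod>m\<in>{1..<i}. (2 * real m + k + 2) / (2 * real m + k))"
    by (intro prod.reindex_bij_witness[of _ "\<lambda>m. i - m" "\<lambda>m. i - m"]) auto
  also have "\<dots> = (2 * real i + k) / (k + 2)"
    using i' by (intro prod_telescope_up) auto
  finally have P1: "(\<Prod>j\<in>{1..<i}. (f j)\<^sup>2) \<ge> (2 * real i + k) / (k + 2)" .
  have g0: "0 \<le> (if m \<le> k then 1 / 4 else (2 * real m - k - 2) / (2 * real m - k))" for m
    using k by auto
  have "(\<Prod>j\<in>{i<..n}. (f j)\<^sup>2) \<ge> (\<Prod>j\<in>{i<..n}. let m = j - i in if m \<le> k then 1 / 4
      else (2 * real m - k - 2) / (2 * real m - k))"
    using down g0 unfolding Let_def by (intro prod_mono conjI) blast+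
  also have "(\<Prod>j\<in>{i<..n}. let m = j - i in if m \<le> k then 1 / 4
      else (2 * real m - k - 2) / (2 * real m - k)) =
      (\<Prod>m\<in>{1..n - i}. if m \<le> k then 1 / 4 else (2 * real m - k - 2) / (2 * real m - k))"
    by (intro prod.reindex_bij_witness[of _ "\<lambda>m. i + m" "\<lambda>j. j - i"]) (auto simp: Let_def)
  also have "\<dots> = (1 / 4) ^ k * (k / (2 * real (n - i) - k))"
    using k bulk by (intro prod_telescope_down) auto
  finally have P2: "(\<Prod>j\<in>{i<..n}. (f j)\<^sup>2) \<ge> (1 / 4) ^ k * (k / (2 * real (n - i) - k))" .
  let ?A = "frob_coeff {1..n} (real_of_int \<circ> beta n r) i"
  have split: "{1..n} - {i} = {1..<i} \<union> {i<..n}" using i' by auto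
  have A: "?A = (\<Prod>j\<in>{1..<i}. f j) * (\<Prod>j\<in>{i<..n}. f j)"
    unfolding frob_coeff_def split by (subst prod.union_disjoint) (auto simp: f_def l_def)
  have A0: "?A \<ge> 0"
    unfolding A using up(1) down(1) by (intro mult_nonneg_nonneg prod_nonneg) auto
  have n: "real n > 0" using i' by simp
  \<comment> \<open>From \<open>n \<le> 3 * i\<close> the quotient
    \<open>(2 * i + k) / (2 * (n - i) - k)\<close> is at least 1/3, and \<open>k / (k + 2)\<close>
    is at least 1/2; 1/6 is then weakened to the square 1/9.\<close>
  have "((1 / 2) ^ k / 3)\<^sup>2 = (1 / 4 :: real) ^ k / 9"
    by (simp add: power_divide power_mult[symmetric] power2_eq_square power_mult_distrib[symmetric])
  also have "\<dots> \<le> (1 / 4) ^ k * (1 / 6)" by simp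
  also have "\<dots> \<le> (1 / 4) ^ k * ((2 * real n / 3) / (2 * real n) * (k / (k + 2)))"
    using k n by (intro mult_left_mono) (auto simp: field_simps)
  also have "\<dots> \<le> (1 / 4) ^ k * ((2 * real i + k) / (2 * real (n - i) - k) * (k / (k + 2)))"
    using k n bulk i' by (intro mult_left_mono mult_right_mono frac_le) auto
  also have "\<dots> = (2 * real i + k) / (k + 2) * ((1 / 4) ^ k * (k / (2 * real (n - i) - k)))"
    by (simp add: mult_ac)
  also have "\<dots> \<le> (\<Prod>j\<in>{1..<i}. (f j)\<^sup>2) * (\<Prod>j\<in>{i<..n}. (f j)\<^sup>2)"
    using P1 P2 k bulk by (intro mult_mono prod_nonneg mult_nonneg_nonneg divide_nonneg_nonneg) auto
  also have "\<dots> = ?A\<^sup>2"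
    unfolding A by (simp add: power_mult_distrib prod_power_distrib)
  finally show ?thesis using A0 by (rule power2_le_imp_le)
qed

lemma staircase_downset_partition:
  assumes D: "D \<subseteq> staircase n"
    and down: "\<And>x y. x \<in> D \<Longrightarrow> y \<in> staircase n \<Longrightarrow> y \<le> x \<Longrightarrow> y \<in> D"
  obtains r where "is_partition n r" "D = young_diagram r" "\<And>j. j \<in> {1..n} \<Longrightarrow> r j \<le> n - j"
proof -
  define r where "r i = (if i = 0 then 0 else Max (insert 0 {c. (i, c) \<in> D}))" for i
  have fin: "finite {c. (i, c) \<in> D}" for i
    by (rule finite_subset[of _ "{..n}"]) (use D in \<open>auto simp: staircase_iff\<close>)
  have mem: "(i, j) \<in> D \<longleftrightarrow> 1 \<le> i \<and> 1 \<le> j \<and> j \<le> r i" for i j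
  proof
    assume "(i, j) \<in> D"
    thus "1 \<le> i \<and> 1 \<le> j \<and> j \<le> r i"
      using D fin[of i] staircase_iff[of i j n] by (auto simp: r_def)
  next
    assume ij: "1 \<le> i \<and> 1 \<le> j \<and> j \<le> r i"
    have "r i \<in> insert 0 {c. (i, c) \<in> D}"
      using ij fin[of i] Max_in[of "insert 0 {c. (i, c) \<in> D}"] by (auto simp: r_def)
    hence "(i, r i) \<in> D" using ij by auto
    moreover from this have "(i, j) \<in> staircase n"
      using D ij by (auto simp: staircase_iff)
    ultimately show "(i, j) \<in> D" using down[of "(i, r i)" "(i, j)"] ij by auto
  qed
  have "r (Suc i) \<le> r i" if "i \<ge> 1" for i
  proof (cases "r (Suc i) = 0")
    case False
    hence "(Suc i, r (Suc i)) \<in> D" by (simp add: mem)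
    moreover from this have "(i, r (Suc i)) \<in> staircase n"
      using D that by (auto simp: staircase_iff)
    ultimately have "(i, r (Suc i)) \<in> D" by (auto intro: down)
    thus ?thesis by (simp add: mem)
  qed simp
  moreover have bound: "r i \<le> n - i" for i
  proof (cases "i = 0 \<or> r i = 0")
    case False
    hence "(i, r i) \<in> D" by (simp add: mem)
    hence "(i, r i) \<in> staircase n" using D by blast
    thus ?thesis by (auto simp: staircase_iff)
  qed (auto simp: r_def)
  ultimately have "is_partition n r"
    using bound by (auto simp: is_partition_def) (metis diff_is_0_eq le_zero_eq less_imp_le)
  moreover have "D = young_diagram r" using mem by (auto simp: young_diagram_def)
  ultimately show thesis using bound that by blast
qed

text \<open>The factor \<open>1 + 2 * k\<close> compares the two \<open>beta\<close> values, the
  rest is \<open>frob_coeff_ratio\<close> for distance 2k.\<close>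

definition corner_ratio :: "nat \<Rightarrow> real" where
  "corner_ratio k = (1 + 2 * real k) * (4 * exp (8 * real k))"

lemma corner_weight_ratio:
  assumes r: "is_partition n r" and i: "i \<in> corner_rows n r" "i' \<in> corner_rows n r"
    and close: "\<bar>beta n r i - beta n r i'\<bar> \<le> int (2 * k)"
  shows "corner_weight n r i' \<le> corner_ratio k * corner_weight n r i"
proof -
  let ?A = "frob_coeff {1..n} (real_of_int \<circ> beta n r)"
  \<comment> \<open>The sign of the coefficient is read off from the counting identity: a weight
    proportional to a cardinality cannot be negative.\<close>
  have weight_pos: "beta n r j \<ge> 1" "?A j \<ge> 0" if j: "j \<in> corner_rows n r" for j
  proof -
    show b: "beta n r j \<ge> 1" using j by (auto simp: corner_rows_def beta_def)
    have fin: "finite (young_diagram r)" by (rule finite_young_diagram[OF r])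
    hence "card (removal_orders (young_diagram r)) > 0"
      by (simp add: card_gt_0_iff removal_orders_nonempty finite_removal_orders)
    moreover have "0 \<le> corner_weight n r j * card (removal_orders (young_diagram r))"
      unfolding card_removal_orders_corner[OF r j, symmetric] by simp
    ultimately have "0 \<le> corner_weight n r j" by (simp add: zero_le_mult_iff)
    thus "?A j \<ge> 0" using b by (simp add: zero_le_mult_iff)
  qed
  show ?thesis
  proof (cases "i = i'")
    case True
    have "1 * 1 \<le> corner_ratio k"
      unfolding corner_ratio_def
    proof (intro mult_mono)
      show "1 \<le> 4 * exp (8 * real k)"
        using exp_ge_add_one_self[of "8 * real k"] by linarith
    qed auto
    hence "1 * corner_weight n r i \<le> corner_ratio k * corner_weight n r i"
      using weight_pos[OF i(1)] by (intro mult_right_mono mult_nonneg_nonneg) auto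
    thus ?thesis using True by simp
  next
    case False
    have corner: "beta n r i - beta n r j \<noteq> 1" if j: "j \<in> {1..n}" for j
    proof
      assume eq: "beta n r i - beta n r j = 1"
      hence "\<not> j \<le> i"
        using beta_strict_antimono[OF r, of j i] j by (cases "j = i") auto
      hence "r j \<le> r (Suc i)" using partition_antimono[OF r, of "Suc i" j] by auto
      thus False using eq i(1) \<open>\<not> j \<le> i\<close> by (auto simp: beta_def corner_rows_def)
    qed
    have A: "?A i' \<le> 4 * exp (8 * real k) * ?A i"
      using frob_coeff_ratio[OF _ inj_on_beta[OF r], of i i' "2 * k"] corner close i False
      by (auto simp: corner_rows_def)
    \<comment> \<open>An additive distance becomes a multiplicative bound because
      \<open>beta n r i\<close> is an integer at least 1.\<close>
    have "beta n r i' \<le> beta n r i + 2 * int k * beta n r i"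
    proof -
      have "int (2 * k) * 1 \<le> int (2 * k) * beta n r i"
        using weight_pos(1)[OF i(1)] by (intro mult_left_mono) auto
      thus ?thesis using close by (simp add: abs_le_iff)
    qed
    hence b: "real_of_int (beta n r i') \<le> (1 + 2 * real k) * beta n r i"
      by (metis (mono_tags, lifting) distrib_right mult_1 of_int_add of_int_le_iff of_int_mult
          of_int_numeral of_int_of_nat_eq)
    have "corner_weight n r i' \<le> ((1 + 2 * real k) * beta n r i) * (4 * exp (8 * real k) * ?A i)"
      using A b weight_pos(1)[OF i(1)] weight_pos(2)[OF i(2)] by (intro mult_mono) auto
    thus ?thesis by (simp add: corner_ratio_def mult_ac)
  qed
qed

section \<open>Blocks in the staircase\<close>

lemma removal_orders_map:
  assumes "xs \<in> removal_orders D" and "\<And>x y. x \<in> D \<Longrightarrow> y \<in> D \<Longrightarrow> f x \<le> f y \<Longrightarrow> x \<le> y"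
  shows "map f xs \<in> removal_orders (f ` D)"
proof -
  have "sorted_wrt (\<lambda>x y. \<not> f x \<le> f y) xs"
    using assms by (auto simp: removal_orders_def intro: sorted_wrt_mono_rel[rotated])
  thus ?thesis using assms(1) by (auto simp: removal_orders_def sorted_wrt_map)
qed

text \<open>The coordinates add up to n + 2 - k, so the subdiagram starting here is a staircase of
  size \<open>k\<close> whose outer diagonal lies on the antidiagonal of the large one.\<close>

definition block_corner :: "nat \<Rightarrow> nat \<Rightarrow> nat \<Rightarrow> box" where
  "block_corner k n i = (i, n + 2 - k - i)"

definition shift :: "nat \<Rightarrow> nat \<Rightarrow> nat \<Rightarrow> box \<Rightarrow> box" where
  "shift k n i = (\<lambda>(x, y). (x + i - 1, y + (n + 1 - k - i)))"

definition block :: "nat \<Rightarrow> nat \<Rightarrow> nat \<Rightarrow> box set" where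
  "block k n i = subdiagram (staircase n) (block_corner k n i)"

lemma in_block_iff:
  "(x, y) \<in> block k n i \<longleftrightarrow>
     1 \<le> x \<and> 1 \<le> y \<and> x + y \<le> n \<and> i \<le> x \<and> n + 2 - k - i \<le> y"
  by (auto simp: block_def block_corner_def subdiagram_def staircase_iff)

lemma block_eq_shift:
  assumes "1 \<le> i" "i + k \<le> n + 1"
  shows "block k n i = shift k n i ` staircase k"
proof (intro set_eqI iffI)
  fix p assume p: "p \<in> block k n i"
  obtain x y where xy: "p = (x, y)" by (cases p)
  have "p = shift k n i (x + 1 - i, y - (n + 1 - k - i))"
    using p assms by (auto simp: xy in_block_iff shift_def)
  moreover have "(x + 1 - i, y - (n + 1 - k - i)) \<in> staircase k"
    using p assms by (auto simp: xy in_block_iff staircase_iff)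
  ultimately show "p \<in> shift k n i ` staircase k" by blast
qed (use assms in \<open>auto simp: in_block_iff shift_def staircase_iff\<close>)

lemma shift_le_iff:
  assumes "1 \<le> i"
  shows "shift k n i p \<le> shift k n i q \<longleftrightarrow> p \<le> q"
  using assms by (cases p; cases q) (auto simp: shift_def)

lemma inj_shift: "1 \<le> i \<Longrightarrow> inj (shift k n i)"
  by (auto simp: inj_def shift_def)

lemma block_upset: "p \<in> block k n i \<Longrightarrow> q \<in> staircase n \<Longrightarrow> p \<le> q \<Longrightarrow> q \<in> block k n i"
  by (auto simp: block_def subdiagram_def intro: order_trans)

lemma block_corner_in:
  assumes "1 \<le> i" "i + k \<le> n + 1" "k \<ge> 2"
  shows "block_corner k n i \<in> block k n i"
  using assms by (auto simp: block_corner_def in_block_iff)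

text \<open>Together the inequalities give \<open>n \<le> r j + j + k\<close>, the depth required by
  \<open>frob_coeff_lower\<close>, and \<open>j + 2 \<le> i + k\<close>, so the corner stays in the
  rows of its block.\<close>

lemma maximal_in_block:
  assumes r: "is_partition n r" and x: "x \<in> maximals (young_diagram r) \<inter> block k n i"
  obtains j where "x = (j, r j)" "j \<in> corner_rows n r" "i \<le> j" "j + r j \<le> n" "n + 2 \<le> r j + k + i"
proof -
  obtain j where "x = (j, r j)" "j \<in> corner_rows n r"
    using x maximals_young_diagram[OF r] by auto
  moreover from this have "(j, r j) \<in> block k n i" using x by simp
  ultimately show thesis using that[of j] by (auto simp: in_block_iff)
qed

text \<open>The product of n/3, a lower bound for \<open>beta\<close>, and
  \<open>(1 / 2) ^ k / 3\<close> from \<open>frob_coeff_lower\<close>, divided by n^2/2, an upper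
  bound for the number of boxes.\<close>

definition corner_rate :: "nat \<Rightarrow> nat \<Rightarrow> real" where
  "corner_rate k n = 2 * (1 / 2) ^ k / (9 * real n)"

lemma staircase_rate:
  assumes D: "D \<subseteq> staircase n" "\<And>x y. x \<in> D \<Longrightarrow> y \<in> staircase n \<Longrightarrow> y \<le> x \<Longrightarrow> y \<in> D"
    and x: "x \<in> maximals D \<inter> block k n i"
    and k: "k \<ge> 2" and i: "n \<le> 3 * i" "3 * (i + 2 * k) \<le> 2 * n"
  shows "corner_rate k n * card (removal_orders D) \<le> card (removal_orders (D - {x}))"
proof -
  obtain r where r: "is_partition n r" "D = young_diagram r" "\<And>j. j \<in> {1..n} \<Longrightarrow> r j \<le> n - j"
    using staircase_downset_partition[OF D(1)] D(2) by metis
  obtain j where j: "x = (j, r j)" "j \<in> corner_rows n r" "i \<le> j" "j + r j \<le> n" "n + 2 \<le> r j + k + i"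
    using maximal_in_block[OF r(1)] x r(2) by blast
  have jb: "j + 2 \<le> i + k" using j by linarith
  have n: "n > 0" using i(2) k by (cases n) auto
  have A: "(1 / 2) ^ k / 3 \<le> frob_coeff {1..n} (real_of_int \<circ> beta n r) j"
    by (rule frob_coeff_lower[OF r(1,3) j(2) k]) (use j jb i in auto)
  \<comment> \<open>The block ends before row 2n/3, so the shift \<open>n - j\<close> alone is
    already at least n/3.\<close>
  have b: "real n / 3 \<le> real_of_int (beta n r j)"
    using j jb i by (simp add: beta_def)
  have "real n / 3 * ((1 / 2) ^ k / 3) \<le> corner_weight n r j"
    using A b by (intro mult_mono) auto
  hence "real n / 3 * ((1 / 2) ^ k / 3) * card (removal_orders D)
      \<le> corner_weight n r j * card (removal_orders D)"
    by (intro mult_right_mono) auto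
  also have "\<dots> = real (card D) * card (removal_orders (D - {x}))"
    using card_removal_orders_corner[OF r(1) j(2)] r(2) j(1) by simp
  also have "\<dots> \<le> ((real n)\<^sup>2 / 2) * card (removal_orders (D - {x}))"
  proof (intro mult_right_mono)
    have "card D \<le> n choose 2"
      using card_mono[OF finite_staircase D(1)] by (simp add: card_staircase)
    hence "real (card D) \<le> real (n choose 2)" by simp
    also have "\<dots> \<le> (real n)\<^sup>2 / 2"
    proof -
      have "2 * (n choose 2) \<le> n * (n - 1)"
        unfolding choose_two by (rule times_div_less_eq_dividend)
      also have "\<dots> \<le> n\<^sup>2" by (simp add: power2_eq_square)
      finally have "2 * (n choose 2) \<le> n\<^sup>2" .
      hence "real (2 * (n choose 2)) \<le> real (n\<^sup>2)" by (rule of_nat_mono)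
      thus ?thesis by simp
    qed
    finally show "real (card D) \<le> (real n)\<^sup>2 / 2" .
  qed simp
  finally show ?thesis
    using n by (simp add: corner_rate_def field_simps power2_eq_square)
qed

text \<open>A block meets at most \<open>k\<close> rows and hence at most \<open>k\<close> corners.
  Rows and row lengths at these corners vary by less than \<open>k\<close> each, so their
  \<open>beta\<close> values differ by at most 2k.\<close>

lemma staircase_ratio:
  assumes D: "D \<subseteq> staircase n" "\<And>x y. x \<in> D \<Longrightarrow> y \<in> staircase n \<Longrightarrow> y \<le> x \<Longrightarrow> y \<in> D"
    and x: "x \<in> maximals D \<inter> block k n i"
  shows "(\<Sum>y\<in>maximals D \<inter> block k n i - {x}. real (card (removal_orders (D - {y}))))
    \<le> k * corner_ratio k * card (removal_orders (D - {x}))"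
proof -
  obtain r where r: "is_partition n r" "D = young_diagram r" "\<And>j. j \<in> {1..n} \<Longrightarrow> r j \<le> n - j"
    using staircase_downset_partition[OF D(1)] D(2) by metis
  obtain j where j: "x = (j, r j)" "j \<in> corner_rows n r" "i \<le> j" "j + r j \<le> n" "n + 2 \<le> r j + k + i"
    using maximal_in_block[OF r(1)] x r(2) by blast
  have D0: "real (card D) > 0"
    using x D(1) finite_staircase finite_subset maximals_subset[of D] by (auto simp: card_gt_0_iff)
  let ?Y = "maximals D \<inter> block k n i - {x}"
  have le: "real (card (removal_orders (D - {y}))) \<le> corner_ratio k * card (removal_orders (D - {x}))"
    if y: "y \<in> ?Y" for y
  proof -
    obtain j' where j': "y = (j', r j')" "j' \<in> corner_rows n r" "i \<le> j'" "j' + r j' \<le> n"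
        "n + 2 \<le> r j' + k + i"
      using maximal_in_block[OF r(1), of y] y r(2) by blast
    have "\<bar>beta n r j - beta n r j'\<bar> \<le> int (2 * k)"
      using j j' by (simp add: beta_def)
    hence "corner_weight n r j' \<le> corner_ratio k * corner_weight n r j"
      by (rule corner_weight_ratio[OF r(1) j(2) j'(2)])
    hence "corner_weight n r j' * card (removal_orders D)
        \<le> corner_ratio k * corner_weight n r j * card (removal_orders D)"
      by (intro mult_right_mono) auto
    hence "real (card D) * card (removal_orders (D - {y})) \<le>
        real (card D) * (corner_ratio k * card (removal_orders (D - {x})))"
      using card_removal_orders_corner[OF r(1) j(2)] card_removal_orders_corner[OF r(1) j'(2)]
      by (simp add: r(2) j(1) j'(1) mult_ac)
    thus ?thesis using D0 by simp
  qed
  have card_Y: "card ?Y \<le> k"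
  proof -
    have "?Y \<subseteq> (\<lambda>j. (j, r j)) ` {i..<i + k}"
    proof
      fix y assume y: "y \<in> ?Y"
      then obtain j' where "y = (j', r j')" "i \<le> j'" "j' + r j' \<le> n" "n + 2 \<le> r j' + k + i"
        using maximal_in_block[OF r(1), of y] r(2) by blast
      thus "y \<in> (\<lambda>j. (j, r j)) ` {i..<i + k}" by auto
    qed
    hence "card ?Y \<le> card {i..<i + k}" by (rule surj_card_le[rotated]) simp
    thus ?thesis by simp
  qed
  have "(\<Sum>y\<in>?Y. real (card (removal_orders (D - {y}))))
      \<le> real (card ?Y) * (corner_ratio k * card (removal_orders (D - {x})))"
    using le by (rule sum_bounded_above)
  also have "\<dots> \<le> k * (corner_ratio k * card (removal_orders (D - {x})))"
    using card_Y by (intro mult_right_mono) (auto simp: corner_ratio_def)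
  finally show ?thesis by (simp add: mult.assoc)
qed

text \<open>Blocks start after the first third of the rows, \<open>k\<close> rows apart. The n div
  (6k) blocks used fill about n/6 rows, so for \<open>24 * k \<le> n\<close> they stay below row
  2n/3 with 2k rows to spare.\<close>

definition block_row :: "nat \<Rightarrow> nat \<Rightarrow> nat \<Rightarrow> nat" where
  "block_row k n b = n div 3 + 1 + b * k"

lemma block_row_bounds:
  assumes k: "k \<ge> 2" and n: "24 * k \<le> n" and b: "b < n div (6 * k)"
  shows "1 \<le> block_row k n b" "n \<le> 3 * block_row k n b"
    "3 * (block_row k n b + 2 * k) \<le> 2 * n" "block_row k n b + k \<le> n"
proof -
  have "b * (6 * k) \<le> n div (6 * k) * (6 * k)" by (rule mult_le_mono1[OF less_imp_le[OF b]])
  also have "\<dots> \<le> n" by (rule div_times_less_eq_dividend)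
  finally have bk: "6 * (b * k) \<le> n" by (simp add: mult_ac)
  define q where "q = n div 3"
  have q: "3 * q \<le> n" "n \<le> 3 * q + 3" unfolding q_def by simp presburger
  have row: "block_row k n b = q + 1 + b * k" by (simp add: block_row_def q_def)
  show "1 \<le> block_row k n b" "n \<le> 3 * block_row k n b"
    unfolding row using q(2) by auto
  have "3 * q + 3 * z + 3 + 6 * k \<le> 2 * n" if "6 * z \<le> n" for z
    using q(1) that n k by linarith
  from this[OF bk] have le: "3 * block_row k n b + 6 * k \<le> 2 * n"
    by (simp add: row)
  thus "3 * (block_row k n b + 2 * k) \<le> 2 * n" by simp
  from le show "block_row k n b + k \<le> n" by linarith
qed

lemma blocks_staircase:
  assumes k: "k \<ge> 2" and n: "24 * k \<le> n" and t: "t \<in> removal_orders (staircase k)"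
  shows "blocks (staircase n) {..<n div (6 * k)} (\<lambda>b. block k n (block_row k n b))
    (\<lambda>b. map (shift k n (block_row k n b)) t) (k choose 2) (k * corner_ratio k) (corner_rate k n)"
proof (rule blocks.intro)
  note bounds = block_row_bounds[OF k n]
  fix b assume "b \<in> {..<n div (6 * k)}"
  hence b: "b < n div (6 * k)" by simp
  let ?i = "block_row k n b"
  show "block k n ?i \<subseteq> staircase n" by (auto simp: block_def subdiagram_def)
  have shift: "block k n ?i = shift k n ?i ` staircase k"
    using bounds[OF b] by (intro block_eq_shift) auto
  show "map (shift k n ?i) t \<in> removal_orders (block k n ?i)"
    unfolding shift using bounds[OF b] by (intro removal_orders_map[OF t]) (simp add: shift_le_iff)
  show "card (block k n ?i) = k choose 2"
    unfolding shift using card_image[OF inj_on_subset[OF inj_shift[OF bounds(1)[OF b]] subset_UNIV]]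
    by (simp add: card_staircase)
  show "y \<in> block k n ?i" if "x \<in> block k n ?i" "y \<in> staircase n" "x \<le> y" for x y
    using that by (rule block_upset)
  show "block k n ?i \<inter> block k n (block_row k n b') = {}" if "b \<noteq> b'" for b'
  proof -
    \<comment> \<open>The block starting in row \<open>i\<close> occupies only rows up to i + k - 2,
      so a later block starts strictly below it.\<close>
    have rows: "p \<notin> block k n (block_row k n c')" if "p \<in> block k n (block_row k n c)" "c < c'" for p c c'
    proof
      assume p': "p \<in> block k n (block_row k n c')"
      obtain x y where xy: "p = (x, y)" by (cases p)
      have "c * k + k \<le> c' * k" using \<open>c < c'\<close> mult_le_mono1[of "Suc c" c' k] by simp
      thus False using p' that(1) k by (auto simp: xy in_block_iff block_row_def)
    qed
    show ?thesis using rows \<open>b \<noteq> b'\<close> by (cases b b' rule: linorder_cases) blast+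
  qed
  fix D :: "box set" and x assume D: "D \<subseteq> staircase n" "\<And>x y. x \<in> D \<Longrightarrow> y \<in> staircase n \<Longrightarrow> y \<le> x \<Longrightarrow> y \<in> D"
    and x: "x \<in> maximals D \<inter> block k n ?i"
  show "corner_rate k n * card (removal_orders D) \<le> card (removal_orders (D - {x}))"
    using bounds[OF b] k by (intro staircase_rate[OF D x]) auto
  show "(\<Sum>y\<in>maximals D \<inter> block k n ?i - {x}. real (card (removal_orders (D - {y}))))
    \<le> k * corner_ratio k * card (removal_orders (D - {x}))"
    by (rule staircase_ratio[OF D x])
qed (auto simp: finite_staircase corner_ratio_def corner_rate_def)

section \<open>Tableaux as removal orders\<close>

definition tableau_of :: "box list \<Rightarrow> tableau" where
  "tableau_of xs = map_of (zip xs (map (\<lambda>i. int (length xs - i)) [0..<length xs]))"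

lemma dom_tableau_of [simp]: "dom (tableau_of xs) = set xs"
  by (simp add: tableau_of_def)

lemma tableau_of_nth:
  "distinct xs \<Longrightarrow> i < length xs \<Longrightarrow> tableau_of xs (xs ! i) = Some (int (length xs - i))"
  by (simp add: tableau_of_def map_of_zip_nth)

lemma sorted_wrt_tableau_of:
  assumes "distinct xs"
  shows "sorted_wrt (\<lambda>x y. the (tableau_of xs y) < the (tableau_of xs x)) xs"
  using assms by (auto simp: sorted_wrt_iff_nth_less tableau_of_nth)

lemma ran_tableau_of:
  assumes "distinct xs"
  shows "ran (tableau_of xs) = {1..int (length xs)}"
proof -
  have "ran (tableau_of xs) = (\<lambda>i. int (length xs - i)) ` {0..<length xs}"
    using assms by (simp add: tableau_of_def ran_map_of_zip)
  also have "\<dots> = {1..int (length xs)}"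
  proof (intro set_eqI iffI)
    fix e assume "e \<in> {1..int (length xs)}"
    thus "e \<in> (\<lambda>i. int (length xs - i)) ` {0..<length xs}"
      by (intro image_eqI[of _ _ "length xs - nat e"]) auto
  qed auto
  finally show ?thesis .
qed

lemma staircase_tableau_mono:
  assumes U: "U \<in> staircase_tableaux n" and xy: "x \<in> staircase n" "y \<in> staircase n" "x \<le> y"
  shows "the (U x) \<le> the (U y)"
proof -
  obtain i j k l where ij: "x = (i, j)" "y = (k, l)" by (cases x; cases y)
  have "(i, l) \<in> staircase n" using xy by (auto simp: ij staircase_iff)
  hence "the (U (i, j)) \<le> the (U (i, l))" "the (U (i, l)) \<le> the (U (k, l))"
    using U xy by (auto simp: ij staircase_tableaux_def standard_young_tableaux_def is_tableau_def)
  thus ?thesis by (simp add: ij)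
qed

lemma tableau_of_staircase:
  assumes xs: "xs \<in> removal_orders (staircase n)"
  shows "tableau_of xs \<in> staircase_tableaux n"
proof -
  have d: "distinct xs" and s: "set xs = staircase n"
    using xs removal_orders_distinct by (auto simp: removal_orders_def)
  have len: "length xs = card (staircase n)" using removal_orders_length[OF xs] .
  have "the (tableau_of xs x) \<le> the (tableau_of xs y)" if "x \<in> staircase n" "y \<in> staircase n" "x \<le> y" for x y
  proof -
    have "x \<in> set xs" "y \<in> set xs" using that s by auto
    then obtain a b where ab: "x = xs ! a" "a < length xs" "y = xs ! b" "b < length xs"
      unfolding in_set_conv_nth by blast
    have "\<not> a < b"
      using xs that ab by (auto simp: removal_orders_def sorted_wrt_iff_nth_less)
    thus ?thesis using ab d by (simp add: tableau_of_nth)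
  qed
  thus ?thesis
    using s ran_tableau_of[OF d] len
    by (auto simp: staircase_tableaux_def standard_young_tableaux_def is_tableau_def)
qed

lemma ex_removal_order:
  assumes U: "U \<in> staircase_tableaux n"
  obtains xs where "xs \<in> removal_orders (staircase n)" "U = tableau_of xs"
proof -
  let ?D = "staircase n"
  let ?N = "card ?D"
  define g where "g = the \<circ> U"
  have dom: "dom U = ?D" and ran: "ran U = {1..int ?N}"
    using U by (auto simp: staircase_tableaux_def standard_young_tableaux_def is_tableau_def)
  have "ran U = g ` dom U" by (force simp: ran_def g_def)
  hence "g ` ?D = {1..int ?N}" unfolding ran dom by simp
  \<comment> \<open>The definition of a standard tableau fixes only the set of entries; injectivity
    follows by counting.\<close>
  moreover from this have "inj_on g ?D"
    by (intro eq_card_imp_inj_on finite_staircase) simp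
  ultimately have bij: "bij_betw g ?D {1..int ?N}" by (simp add: bij_betw_def)
  define xs where "xs = map (\<lambda>s. inv_into ?D g (int (?N - s))) [0..<?N]"
  have len: "length xs = ?N" by (simp add: xs_def)
  have nth: "xs ! a \<in> ?D" "g (xs ! a) = int (?N - a)" if "a < ?N" for a
  proof -
    have "int (?N - a) \<in> g ` ?D" using that bij by (auto simp: bij_betw_def)
    thus "xs ! a \<in> ?D" "g (xs ! a) = int (?N - a)"
      using that by (auto simp: xs_def intro: inv_into_into f_inv_into_f)
  qed
  have set: "set xs = ?D"
  proof
    show "set xs \<subseteq> ?D" using nth(1) unfolding len[symmetric] by (metis in_set_conv_nth subsetI)
    show "?D \<subseteq> set xs"
    proof
      fix x assume x: "x \<in> ?D"
      hence gx: "g x \<in> {1..int ?N}" using bij by (auto simp: bij_betw_def)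
      define a where "a = ?N - nat (g x)"
      have a: "a < ?N" "int (?N - a) = g x" using gx by (auto simp: a_def)
      hence "g (xs ! a) = g x" using nth(2)[of a] by simp
      hence "xs ! a = x" using bij x nth(1)[OF a(1)] by (auto simp: bij_betw_def inj_on_def)
      thus "x \<in> set xs" using a len by auto
    qed
  qed
  have "\<not> xs ! a \<le> xs ! b" if "a < b" "b < ?N" for a b
    using staircase_tableau_mono[OF U nth(1)[of a] nth(1)[of b]] nth(2)[of a] nth(2)[of b] that
    by (auto simp: g_def)
  hence R: "xs \<in> removal_orders ?D"
    using set by (auto simp: removal_orders_def sorted_wrt_iff_nth_less len)
  have "U x = tableau_of xs x" for x
  proof (cases "x \<in> ?D")
    case True
    then obtain a where a: "x = xs ! a" "a < ?N" using set len by (metis in_set_conv_nth)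
    have "U x \<noteq> None" using True dom by auto
    hence "U x = Some (int (?N - a))" using nth(2)[OF a(2)] a by (auto simp: g_def)
    thus ?thesis using a len removal_orders_distinct[OF R] by (simp add: tableau_of_nth)
  next
    case False
    hence "x \<notin> dom U" "x \<notin> dom (tableau_of xs)" using dom set by auto
    thus ?thesis by (metis domIff)
  qed
  thus thesis using that R by blast
qed

lemma inj_on_tableau_of: "inj_on tableau_of (removal_orders D)"
proof
  fix xs ys assume xs: "xs \<in> removal_orders D" and ys: "ys \<in> removal_orders D"
    and eq: "tableau_of xs = tableau_of ys"
  note d = removal_orders_distinct[OF xs] removal_orders_distinct[OF ys]
  have len: "length xs = length ys" using removal_orders_length xs ys by metis
  show "xs = ys"
  proof (rule nth_equalityI[OF len])
    fix i assume i: "i < length xs"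
    have "xs ! i \<in> set ys" using i xs ys nth_mem[OF i] by (auto simp: removal_orders_def)
    then obtain j where j: "j < length ys" "xs ! i = ys ! j" by (metis in_set_conv_nth)
    have "Some (int (length xs - i)) = Some (int (length ys - j))"
      using tableau_of_nth[OF d(1) i] tableau_of_nth[OF d(2) j(1)] eq j(2) by simp
    hence "i = j" using i j len by auto
    thus "xs ! i = ys ! i" using j by simp
  qed
qed

lemma staircase_tableaux_eq: "staircase_tableaux n = tableau_of ` removal_orders (staircase n)"
  using tableau_of_staircase ex_removal_order by blast

lemma card_staircase_tableaux: "card (staircase_tableaux n) = card (removal_orders (staircase n))"
  unfolding staircase_tableaux_eq by (rule card_image[OF inj_on_tableau_of])

text \<open>The order in which the block's boxes leave determines the relative order of their
  entries, since earlier removal means a larger entry. All of them leave within the first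
  \<open>m\<close> steps, when the entries given out exceed N - m.\<close>

lemma identically_ordered_block:
  assumes xs: "xs \<in> removal_orders (staircase n)" and t: "t \<in> removal_orders (staircase k)"
    and i: "1 \<le> i" "i + k \<le> n + 1"
    and tr: "filter (\<lambda>x. x \<in> block k n i) (take m xs) = map (shift k n i) t"
  shows "identically_ordered (subtableau (tableau_of xs) (block_corner k n i)) (tableau_of t)"
    and "\<forall>e\<in>ran (subtableau (tableau_of xs) (block_corner k n i)). e > int (n choose 2) - int m"
proof -
  let ?U = "tableau_of xs" and ?T = "tableau_of t"
  let ?V = "subtableau ?U (block_corner k n i)"
  have d: "distinct xs" "distinct t" using xs t removal_orders_distinct by auto
  have set: "set xs = staircase n" "set t = staircase k" using xs t by (auto simp: removal_orders_def)
  have V: "?V = ?U |` block k n i"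
    by (simp add: subtableau_def block_def set)
  have B: "block k n i = shift k n i ` staircase k" using i by (intro block_eq_shift) auto
  have dom_V: "dom ?V = block k n i"
    unfolding V using set by (auto simp: block_def subdiagram_def)
  have V_eq: "?V x = ?U x" if "x \<in> block k n i" for x using that by (simp add: V)
  \<comment> \<open>The inverse of \<open>shift\<close>, because the copy inside the large tableau
    is the first argument of \<open>identically_ordered\<close>.\<close>
  define \<theta> :: "box \<Rightarrow> box" where "\<theta> = (\<lambda>(x, y). (x + 1 - i, y - (n + 1 - k - i)))"
  have \<theta>: "\<theta> (shift k n i p) = p" for p
    using i by (cases p) (auto simp: \<theta>_def shift_def)
  have trans: "translation_on (dom ?V) \<theta>"
    unfolding translation_on_def dom_V
  proof (intro exI ballI)
    fix p assume p: "p \<in> block k n i"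
    obtain x y where xy: "p = (x, y)" by (cases p)
    show "int (fst (\<theta> p)) = int (fst p) + (1 - int i) \<and>
        int (snd (\<theta> p)) = int (snd p) + (- int (n + 1 - k - i))"
      using p i by (auto simp: xy in_block_iff \<theta>_def)
  qed
  have bij: "bij_betw \<theta> (dom ?V) (dom ?T)"
    unfolding dom_V B by (rule bij_betwI[where g = "shift k n i"]) (auto simp: \<theta> set)
  have "sorted_wrt (\<lambda>x y. the (?U y) < the (?U x)) (map (shift k n i) t)"
    unfolding tr[symmetric]
    by (intro sorted_wrt_filter sorted_wrt_take sorted_wrt_tableau_of d)
  hence U_less: "the (?U (shift k n i (t ! b))) < the (?U (shift k n i (t ! a)))"
    if "a < b" "b < length t" for a b
    using that by (simp add: sorted_wrt_iff_nth_less)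
  have T_less: "the (?T (t ! b)) < the (?T (t ! a))" if "a < b" "b < length t" for a b
    using sorted_wrt_tableau_of[OF d(2)] that by (simp add: sorted_wrt_iff_nth_less)
  have order: "the (?U (shift k n i p)) < the (?U (shift k n i q)) \<longleftrightarrow> the (?T p) < the (?T q)"
    if "p \<in> staircase k" "q \<in> staircase k" for p q
  proof -
    have "p \<in> set t" "q \<in> set t" using that set(2) by auto
    then obtain a b where ab: "p = t ! a" "a < length t" "q = t ! b" "b < length t"
      unfolding in_set_conv_nth by blast
    show ?thesis
    proof (cases a b rule: linorder_cases)
      case less
      show ?thesis
        using U_less[OF less ab(4)] T_less[OF less ab(4)] unfolding ab(1,3) by linarith
    next
      case greater
      show ?thesis
        using U_less[OF greater ab(2)] T_less[OF greater ab(2)] unfolding ab(1,3) by linarith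
    next
      case equal
      show ?thesis unfolding ab(1,3) equal by simp
    qed
  qed
  show "identically_ordered ?V ?T"
    unfolding identically_ordered_def
  proof (intro exI[of _ \<theta>] conjI ballI trans bij)
    fix x y assume xy: "x \<in> dom ?V" "y \<in> dom ?V"
    then obtain p q where pq: "p \<in> staircase k" "x = shift k n i p" "q \<in> staircase k" "y = shift k n i q"
      unfolding dom_V B by blast
    show "the (?V x) < the (?V y) \<longleftrightarrow> the (?T (\<theta> x)) < the (?T (\<theta> y))"
      using V_eq[of x] V_eq[of y] xy order[of p q] pq by (simp add: dom_V \<theta>)
  qed
  show "\<forall>e\<in>ran ?V. e > int (n choose 2) - int m"
  proof
    fix e assume "e \<in> ran ?V"
    then obtain x where x: "?V x = Some e" by (auto simp: ran_def)
    hence xB: "x \<in> block k n i" using dom_V by blast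
    hence "x \<in> set (map (shift k n i) t)" using set(2) by (simp add: B)
    hence "x \<in> set (take m xs)" unfolding tr[symmetric] by simp
    then obtain a where a: "a < m" "a < length xs" "x = xs ! a"
      by (auto simp: in_set_conv_nth)
    have "e = int (length xs - a)" using x V_eq[OF xB] a d by (simp add: tableau_of_nth)
    moreover have "length xs = n choose 2"
      using removal_orders_length[OF xs] by (simp add: card_staircase)
    ultimately show "e > int (n choose 2) - int m" using a by simp
  qed
qed

section \<open>Choice of the constants and the probability bound\<close>

definition many_copies :: "real \<Rightarrow> real \<Rightarrow> nat \<Rightarrow> tableau \<Rightarrow> tableau set" where
  "many_copies c1 c2 n T = {U. \<exists>F \<subseteq> subtableaux U.
              real (card F) \<ge> c1 * real n \<and>
              pairwise (\<lambda>V W. disjnt (dom V) (dom W)) F \<and>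
              (\<forall>V\<in>F. identically_ordered V T) \<and>
              (\<forall>V\<in>F. \<forall>e\<in>ran V. real_of_int e > real (n choose 2) - c2 * real n)}"

lemma many_copiesI:
  assumes xs: "xs \<in> removal_orders (staircase n)" and t: "t \<in> removal_orders (staircase k)"
    and k: "k \<ge> 2"
    and rows: "\<And>i. i \<in> R \<Longrightarrow> 1 \<le> i \<and> i + k \<le> n + 1"
    and disj: "\<And>i i'. i \<in> R \<Longrightarrow> i' \<in> R \<Longrightarrow> i \<noteq> i' \<Longrightarrow> block k n i \<inter> block k n i' = {}"
    and tr: "\<And>i. i \<in> R \<Longrightarrow> filter (\<lambda>x. x \<in> block k n i) (take m xs) = map (shift k n i) t"
    and card: "real (card R) \<ge> c1 * real n" and m: "real m \<le> c2 * real n"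
  shows "tableau_of xs \<in> many_copies c1 c2 n (tableau_of t)"
proof -
  let ?U = "tableau_of xs"
  let ?sub = "\<lambda>i. subtableau ?U (block_corner k n i)"
  have U: "set xs = staircase n" using xs by (auto simp: removal_orders_def)
  have dom_sub: "dom (?sub i) = block k n i" for i
    using U by (auto simp: subtableau_def block_def subdiagram_def)
  have corner: "block_corner k n i \<in> block k n i" if "i \<in> R" for i
    using rows[OF that] k by (intro block_corner_in) auto
  \<comment> \<open>Blocks are disjoint and nonempty, so different rows give different subtableaux
    and counting rows counts subtableaux.\<close>
  have inj: "inj_on ?sub R"
  proof
    fix i i' assume "i \<in> R" "i' \<in> R" "?sub i = ?sub i'"
    thus "i = i'" using disj[of i i'] corner[of i] dom_sub[of i] dom_sub[of i'] by auto
  qed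
  have 1: "?sub ` R \<subseteq> subtableaux ?U"
    using corner U by (auto simp: subtableaux_def block_def subdiagram_def)
  have 2: "real (card (?sub ` R)) \<ge> c1 * real n"
    using card by (simp add: card_image[OF inj])
  have 3: "pairwise (\<lambda>V W. disjnt (dom V) (dom W)) (?sub ` R)"
    using disj by (auto simp: pairwise_def disjnt_def dom_sub)
  have 4: "\<forall>V\<in>?sub ` R. identically_ordered V (tableau_of t)"
    using identically_ordered_block(1)[OF xs t _ _ tr] rows by blast
  have 5: "\<forall>V\<in>?sub ` R. \<forall>e\<in>ran V. real_of_int e > real (n choose 2) - c2 * real n"
  proof (intro ballI)
    fix V e assume "V \<in> ?sub ` R" "e \<in> ran V"
    hence "e > int (n choose 2) - int m"
      using identically_ordered_block(2)[OF xs t _ _ tr] rows by blast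
    hence "real_of_int e > real_of_int (int (n choose 2) - int m)"
      by (simp only: of_int_less_iff)
    thus "real_of_int e > real (n choose 2) - c2 * real n" using m by simp
  qed
  show ?thesis
    unfolding many_copies_def using 1 2 3 4 5 by blast
qed

text \<open>Here \<open>e\<close> is \<open>\<eta> 0\<close>. There are at least n/(12k) blocks, so
  e times their number is at least 2cn for c = e/(24k). Tolerating s \<le> cn finished blocks in
  \<open>few_finished\<close> leaves the failure bound exp(-cn).\<close>

lemma prob_many_copies_large:
  assumes k: "k \<ge> 2" and n: "24 * k \<le> n" and T: "T \<in> staircase_tableaux k"
    and e: "e = 1 / 2 / (2 + k * corner_ratio k) ^ (k choose 2)"
    and c2: "c2 \<ge> 1 + 9 * 2 ^ k / (2 * e)"
  shows "measure_pmf.prob (pmf_of_set (staircase_tableaux n)) (many_copies (e / (24 * real k)) c2 n T)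
    \<ge> 1 - exp (- (e / (24 * real k)) * n)"
proof -
  obtain t where t: "t \<in> removal_orders (staircase k)" "T = tableau_of t"
    using ex_removal_order[OF T] by blast
  interpret blocks "staircase n" "{..<n div (6 * k)}" "\<lambda>b. block k n (block_row k n b)"
    "\<lambda>b. map (shift k n (block_row k n b)) t" "k choose 2" "k * corner_ratio k" "corner_rate k n"
    by (rule blocks_staircase[OF k n t(1)])
  note bounds = block_row_bounds[OF k n]
  have e_\<eta>: "\<eta> 0 = e" by (simp add: \<eta>_def e)
  have e0: "e > 0" using \<eta>_pos[of 0] e_\<eta> by simp
  have n0: "n > 0" using n k by linarith
  let ?W = "removal_orders (staircase n)" and ?A = "staircase_tableaux n"
  define c where "c = e / (24 * real k)"
  \<comment> \<open>The least time at which e times \<open>corner_rate k n\<close> times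
    \<open>m\<close> reaches 1; rounding up is absorbed by the summand 1 in the bound on
    \<open>c2\<close>.\<close>
  define m where "m = nat \<lceil>9 * 2 ^ k / (2 * e) * n\<rceil>"
  define s where "s = nat \<lfloor>c * n\<rfloor>"
  let ?E = "many_copies c c2 n T"
  have c0: "c > 0" using e0 k by (simp add: c_def)
  have m_ge: "9 * 2 ^ k / (2 * e) * n \<le> m"
    unfolding m_def by (rule of_nat_ceiling)
  have m_le: "real m \<le> c2 * n"
  proof -
    have "0 \<le> 9 * 2 ^ k / (2 * e) * n" using e0 by simp
    hence "real m \<le> 9 * 2 ^ k / (2 * e) * n + 1"
      unfolding m_def by (simp add: of_nat_nat)
    also have "\<dots> \<le> (1 + 9 * 2 ^ k / (2 * e)) * n" using n0 by (simp add: distrib_right)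
    also have "\<dots> \<le> c2 * n" using c2 by (intro mult_right_mono) auto
    finally show ?thesis .
  qed
  have rate1: "\<eta> 0 * corner_rate k n * m \<ge> 1"
  proof -
    have "1 = e * corner_rate k n * (9 * 2 ^ k / (2 * e) * n)"
      unfolding corner_rate_def power_one_over using e0 n0 by (simp add: field_simps)
    also have "\<dots> \<le> e * corner_rate k n * m"
      using m_ge e0 by (intro mult_left_mono) (auto simp: corner_rate_def)
    finally show ?thesis by (simp add: e_\<eta>)
  qed
  have s: "real s \<le> c * n" "c * n \<le> real s + 1"
    using c0 by (auto simp: s_def of_nat_floor)
  have good: "tableau_of xs \<in> ?E"
    if xs: "xs \<in> ?W" and fin: "\<not> card (finished (take m xs)) \<le> s" for xs
    unfolding t(2)
  proof (rule many_copiesI[OF xs t(1) k])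
    let ?R = "block_row k n ` finished (take m xs)"
    have sub: "finished (take m xs) \<subseteq> {..<n div (6 * k)}" by (auto simp: finished_def)
    show "1 \<le> i \<and> i + k \<le> n + 1" if "i \<in> ?R" for i
      using that sub bounds(1) bounds(4) by fastforce
    show "block k n i \<inter> block k n i' = {}" if "i \<in> ?R" "i' \<in> ?R" "i \<noteq> i'" for i i'
      using that sub S_disjoint by blast
    show "filter (\<lambda>x. x \<in> block k n i) (take m xs) = map (shift k n i) t" if "i \<in> ?R" for i
      using that by (auto simp: finished_def trace_def)
    have "inj_on (block_row k n) (finished (take m xs))"
      using k by (auto simp: inj_on_def block_row_def)
    hence "card ?R = card (finished (take m xs))" by (rule card_image)
    thus "c * n \<le> real (card ?R)" using fin s by linarith
  qed (rule m_le)
  have fin_A: "finite ?A" "?A \<noteq> {}"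
    using finite_staircase_tableaux staircase_tableaux_nonempty by auto
  have cardA: "real (card ?A) > 0" using fin_A by (simp add: card_gt_0_iff)
  have "?A - ?E \<subseteq> tableau_of ` {xs \<in> ?W. card (finished (take m xs)) \<le> s}"
    using good by (auto simp: staircase_tableaux_eq)
  hence "card (?A - ?E) \<le> card {xs \<in> ?W. card (finished (take m xs)) \<le> s}"
    using finite_removal_orders[OF finite_staircase] by (intro surj_card_le) auto
  hence "real (card (?A - ?E)) \<le> card {xs \<in> ?W. card (finished (take m xs)) \<le> s}"
    by simp
  also have "\<dots> \<le> card ?A * exp (s - e * (n div (6 * k)))"
    using few_finished[OF rate1, of s] by (simp add: e_\<eta> card_staircase_tableaux)
  also have "\<dots> \<le> card ?A * exp (- c * n)"
  proof -
    have "real n / (6 * k) - 1 \<le> real (n div (6 * k))"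
    proof -
      have "real n / real (6 * k) < real (n div (6 * k)) + 1"
        using floor_divide_of_nat_eq[of n "6 * k", where 'a = real]
          floor_correct[of "real n / real (6 * k)"] by linarith
      thus ?thesis by simp
    qed
    moreover have "real n / (6 * k) - 1 \<ge> real n / (12 * k)"
      using n k by (simp add: field_simps)
    ultimately have "e * (real n / (12 * k)) \<le> e * (n div (6 * k))"
      using e0 by (intro mult_left_mono) auto
    moreover have "e * (real n / (12 * k)) = 2 * (c * n)"
      by (simp add: c_def field_simps)
    ultimately have "real s - e * (n div (6 * k)) \<le> - c * n" using s by linarith
    thus ?thesis by (intro mult_left_mono) auto
  qed
  finally have bad: "real (card (?A - ?E)) \<le> card ?A * exp (- c * n)" .
  have "real (card (?A \<inter> ?E)) = card ?A - card (?A - ?E)"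
    using fin_A(1) by (metis (no_types, lifting) Diff_Diff_Int Diff_subset card_Diff_subset
        card_mono finite_Diff of_nat_diff)
  hence "real (card ?A) * (1 - exp (- c * n)) \<le> card (?A \<inter> ?E)"
    using bad by (simp add: algebra_simps)
  hence "1 - exp (- c * n) \<le> card (?A \<inter> ?E) / card ?A"
    using cardA by (simp add: pos_le_divide_eq mult.commute)
  thus ?thesis
    using fin_A by (simp add: measure_pmf_of_set c_def)
qed

text \<open>One favourable tableau is enough: empty the block in row 1 first, in the order of
  \<open>T\<close>. With \<open>c1 * n \<le> 1\<close> a single copy suffices, and with
  \<open>c2 \<ge> n\<close> the condition on the entries is automatic.\<close>

lemma prob_many_copies_small:
  assumes k: "k \<ge> 2" and n: "k \<le> n" and T: "T \<in> staircase_tableaux k"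
    and c1: "c1 * n \<le> 1" and c2: "c2 \<ge> n"
  shows "measure_pmf.prob (pmf_of_set (staircase_tableaux n)) (many_copies c1 c2 n T)
    \<ge> 1 / card (staircase_tableaux n)"
proof -
  obtain t where t: "t \<in> removal_orders (staircase k)" "T = tableau_of t"
    using ex_removal_order[OF T] by blast
  let ?B = "block k n 1"
  have "finite (staircase n - ?B)" using finite_staircase by simp
  then obtain zs where zs: "zs \<in> removal_orders (staircase n - ?B)"
    using removal_orders_nonempty by blast
  let ?ys = "map (shift k n 1) t"
  have ys: "?ys \<in> removal_orders ?B"
    using n block_eq_shift[of 1 k n] removal_orders_map[OF t(1), of "shift k n 1"]
    by (simp add: shift_le_iff)
  have xs: "?ys @ zs \<in> removal_orders (staircase n)"
  proof (rule removal_orders_append[OF ys zs])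
    show "?B \<subseteq> staircase n" by (auto simp: block_def subdiagram_def)
  qed (rule block_upset)
  let ?A = "staircase_tableaux n" and ?E = "many_copies c1 c2 n T"
  have "tableau_of (?ys @ zs) \<in> ?E"
    unfolding t(2)
  proof (rule many_copiesI[OF xs t(1) k, of "{1}" "length (?ys @ zs)"])
    have "set ?ys = ?B" "set zs = staircase n - ?B"
      using ys zs by (auto simp: removal_orders_def)
    hence "filter (\<lambda>x. x \<in> ?B) ?ys = ?ys" "filter (\<lambda>x. x \<in> ?B) zs = []"
      by (auto simp: filter_id_conv filter_empty_conv)
    thus "filter (\<lambda>x. x \<in> block k n i) (take (length (?ys @ zs)) (?ys @ zs)) = map (shift k n i) t"
      if "i \<in> {1}" for i
      using that by simp
    have "length (?ys @ zs) = n choose 2"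
      using removal_orders_length[OF xs] by (simp add: card_staircase)
    also have "\<dots> \<le> n * (n - 1)" unfolding choose_two by (rule div_le_dividend)
    also have "\<dots> \<le> n * n" by simp
    finally have "real (length (?ys @ zs)) \<le> real n * real n"
      by (metis of_nat_le_iff of_nat_mult)
    also have "\<dots> \<le> c2 * n" using c2 by (intro mult_right_mono) auto
    finally show "real (length (?ys @ zs)) \<le> c2 * n" .
  qed (use n c1 in auto)
  moreover have "tableau_of (?ys @ zs) \<in> ?A" using xs by (rule tableau_of_staircase)
  ultimately have "?A \<inter> ?E \<noteq> {}" by blast
  hence "1 \<le> card (?A \<inter> ?E)"
    using finite_staircase_tableaux by (simp add: Suc_le_eq card_gt_0_iff)
  hence "1 / card ?A \<le> card (?A \<inter> ?E) / card ?A"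
    by (intro divide_right_mono) auto
  thus ?thesis
    using finite_staircase_tableaux staircase_tableaux_nonempty by (simp add: measure_pmf_of_set)
qed

theorem theorem1p2:
  fixes k :: nat
  assumes "k \<ge> 2"
  shows "\<exists>c1 > (0::real). \<exists>c2 > (0::real). \<exists>c3 > (0::real).
    \<forall>T \<in> staircase_tableaux k. \<forall>n \<ge> k.
      measure_pmf.prob (pmf_of_set (staircase_tableaux n))
        {U. \<exists>F \<subseteq> subtableaux U.
              real (card F) \<ge> c1 * real n \<and>
              pairwise (\<lambda>V W. disjnt (dom V) (dom W)) F \<and>
              (\<forall>V\<in>F. identically_ordered V T) \<and>
              (\<forall>V\<in>F. \<forall>e\<in>ran V. real_of_int e > real (n choose 2) - c2 * real n)}
      \<ge> 1 - exp (- c3 * real n)"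
proof -
  \<comment> \<open>This is \<open>\<eta> 0\<close> for the blocks of the staircase. It depends on
    \<open>k\<close> alone, which makes all constants uniform in \<open>T\<close>.\<close>
  define e where "e = 1 / 2 / (2 + k * corner_ratio k) ^ (k choose 2)"
  define c1 where "c1 = e / (24 * real k)"
  \<comment> \<open>The summand \<open>24 * k\<close> secures \<open>c2 \<ge> n\<close> for the
    small sizes.\<close>
  define c2 where "c2 = 1 + 9 * 2 ^ k / (2 * e) + 24 * k"
  define p where "p = Min (insert 1 ((\<lambda>n. 1 / real (card (staircase_tableaux n))) ` {..<24 * k}))"
  \<comment> \<open>For n < 24k the claim then follows from 1 - exp(- c3 n) \<le> c3 n \<le> p,
    where \<open>p\<close> is at most the probability of any single tableau of such a size.\<close>
  define c3 where "c3 = min c1 (p / (24 * k))"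
  have "1 \<le> (2 + k * corner_ratio k) ^ (k choose 2)"
    by (intro one_le_power) (simp add: corner_ratio_def)
  hence e: "0 < e" "e \<le> 1" by (auto simp: e_def field_simps)
  have "card (staircase_tableaux n) > 0" for n
    using finite_staircase_tableaux staircase_tableaux_nonempty by (simp add: card_gt_0_iff)
  hence p: "p > 0" by (auto simp: p_def)
  have c: "c1 > 0" "c2 > 0" "c3 > 0" "c3 \<le> c1"
    using e p assms by (auto simp: c1_def c2_def c3_def add_pos_nonneg)
  have "measure_pmf.prob (pmf_of_set (staircase_tableaux n)) (many_copies c1 c2 n T)
      \<ge> 1 - exp (- c3 * real n)" if T: "T \<in> staircase_tableaux k" and n: "n \<ge> k" for T n
  proof (cases "24 * k \<le> n")
    case True
    have "1 - exp (- c3 * real n) \<le> 1 - exp (- c1 * real n)"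
      using c by (simp add: mult_right_mono)
    also have "\<dots> \<le> measure_pmf.prob (pmf_of_set (staircase_tableaux n)) (many_copies c1 c2 n T)"
      unfolding c1_def
      by (rule prob_many_copies_large[OF assms True T e_def]) (simp add: c2_def)
    finally show ?thesis .
  next
    case False
    have "1 - exp (- c3 * real n) \<le> c3 * n"
      using exp_ge_add_one_self[of "- c3 * n"] by simp
    also have "\<dots> \<le> (p / (24 * k)) * (24 * k)"
      using False p c by (intro mult_mono) (auto simp: c3_def)
    also have "\<dots> = p" using assms by simp
    also have "\<dots> \<le> 1 / real (card (staircase_tableaux n))"
      unfolding p_def using False by (intro Min_le) auto
    also have "\<dots> \<le> measure_pmf.prob (pmf_of_set (staircase_tableaux n)) (many_copies c1 c2 n T)"
    proof (rule prob_many_copies_small[OF assms n T])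
      have "c1 * n \<le> 1 / (24 * k) * (24 * k)"
        unfolding c1_def using e False by (intro mult_mono frac_le) auto
      thus "c1 * n \<le> 1" using assms by simp
      have "0 \<le> 9 * 2 ^ k / (2 * e)" using e by simp
      thus "real n \<le> c2" using False unfolding c2_def by linarith
    qed
    finally show ?thesis .
  qed
  thus ?thesis using c(1,2,3) unfolding many_copies_def by blast
qed

end
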